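(* Let $n\geq 1$, let $\varpi_0=(n,n-1,\ldots,1)$ be the longest element of $S_n$, and let $\widetilde{\mathfrak S}_{1_m\times\varpi_0}(\Omega+Y,Z)$ be the polynomial defined in the context. For every integer $m\geq 0$, we have $$\widetilde{\mathfrak S}_{1_m\times \varpi_0}(\Omega+Y,Z) = S^{(\delta^\vee_{n-1}(m),\delta^\vee_{n-1})}_{\delta_{n-1}}(h(\Omega+Y,-Z)),$$ that is, $$\widetilde{\mathfrak S}_{1_m\times \varpi_0}(\Omega+Y,Z)=\det\Bigl(h_{n-i+j-i}(\omega_1,\ldots,\omega_m,y_1,\ldots,y_i,-z_1,\ldots,-z_i)\Bigr)_{1\leq i,j\leq n-1}.$$
   Context: $Y=(y_1,y_2,\ldots)$, $Z=(z_1,z_2,\ldots)$ and $\Omega=(\omega_1,\ldots,\omega_m)$ are commuting independent variables, and $\Omega+Y=(\omega_1,\ldots,\omega_m,y_1,y_2,\ldots)$. The nilCoxeter algebra $\mathcal N_N$ of $S_N$ is the free associative unital algebra on $u_1,\ldots,u_{N-1}$ modulo $u_i^2=0$; $u_iu_j=u_ju_i$ for $|i-j|\geq 2$; $u_iu_{i+1}u_i=u_{i+1}u_iu_{i+1}$. For $\varpi\in S_N$ with reduced word $a_1\cdots a_\ell$ (i.e. $\varpi=s_{a_1}\cdots s_{a_\ell}$ with $\ell$ minimal, $s_i=(i,i+1)$) put $u_\varpi=u_{a_1}\cdots u_{a_\ell}$; the $u_\varpi$ form a basis (over the coefficient ring obtained by adjoining the commuting variables). $\langle\xi,\varpi\rangle$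 denotes the coefficient of $u_\varpi$ in $\xi$. Take $N=m+n$. For $i\in[1,m+n-1]$ set $\mathcal A_i(t):=(1+tu_{m+n-1})(1+tu_{m+n-2})\cdots(1+tu_i)$ and $\widetilde{\mathcal A}_i(t):=\mathcal A_i(t)^{-1}$. Put $\mathcal A(\Omega):=\mathcal A_1(\omega_1)\cdots\mathcal A_m(\omega_m)$ and $$\widetilde{\mathfrak S}(\Omega+Y,Z):=\mathcal A(\Omega)\,\mathcal A_{m+1}(y_1)\cdots\mathcal A_{m+n-1}(y_{n-1})\,\widetilde{\mathcal A}_{m+n-1}(z_{n-1})\cdots\widetilde{\mathcal A}_{m+1}(z_1).$$ The permutation $1_m\times\varpi_0\in S_{m+n}$ is given by $(1_m\times\varpi_0)(j)=j$ for $j\leq m$ and $(1_m\times\varpi_0)(j)=m+\varpi_0(j-m)$ for $j>m$. Define $$\widetilde{\mathfrak S}_{1_m\times\varpi_0}(\Omega+Y,Z):=\langle\widetilde{\mathfrak S}(\Omega+Y,Z),1_m\times\varpi_0\rangle.$$ Notation: $\delta_{n-1}=(n-1,n-2,\ldots,1)$, $\delta^\vee_{n-1}(m)=(m+1,\ldots,m+n-1)$, $\delta^\vee_{n-1}=(1,2,\ldots,n-1)$. $h_p$ is the complete homogeneous symmetric polynomial of degree $p$ ($h_0=1$, $h_p=0$ for $p<0$). The flagged Schur polynomial $S_{\delta_{n-1}}^{(\delta^\vee_{n-1}(m),\delta^\vee_{n-1})}(h(\Omega+Y,-Z))$ is the Schur-type determinant of size $n-1$ whose $(i,j)$ entry is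 $h_{(\delta_{n-1})_i+j-i}$ evaluated at the first $m+i$ variables of $\Omega+Y$ together with $-z_1,\ldots,-z_i$. An empty determinant is $1$. *)

theory Defs
  imports
    "HOL-Library.Poly_Mapping"
    "HOL-Combinatorics.Permutations"
    "HOL-Algebra.QuotRing"
    "Jordan_Normal_Form.Determinant"
begin

section \<open>The polynomial ring in the variables of \<open>\<Omega>\<close>, \<open>Y\<close>, \<open>Z\<close>\<close>

text \<open>The ring contains \<open>\<omega>\<^sub>k\<close>, \<open>y\<^sub>k\<close>, \<open>z\<^sub>k\<close> for every \<open>k\<close>; only those with
  \<open>k \<ge> 1\<close>, and among the \<open>\<omega>\<^sub>k\<close> only those with \<open>k \<le> m\<close>, are used.\<close>

datatype variable = Omega_idx nat | Y_idx nat | Z_idx nat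

type_synonym 'k omega_y_z_poly = "(variable \<Rightarrow>\<^sub>0 nat) \<Rightarrow>\<^sub>0 'k"

definition poly_var :: "variable \<Rightarrow> 'k::comm_ring_1 omega_y_z_poly" where
  "poly_var v = Poly_Mapping.single (Poly_Mapping.single v 1) 1"

definition omega_var :: "nat \<Rightarrow> 'k::comm_ring_1 omega_y_z_poly" where
  "omega_var k = poly_var (Omega_idx k)"

definition y_var :: "nat \<Rightarrow> 'k::comm_ring_1 omega_y_z_poly" where
  "y_var k = poly_var (Y_idx k)"

definition z_var :: "nat \<Rightarrow> 'k::comm_ring_1 omega_y_z_poly" where
  "z_var k = poly_var (Z_idx k)"


section \<open>The free associative algebra\<close>

text \<open>Words under concatenation. A separate type is needed because the multiplication of
  \<^type>\<open>poly_mapping\<close> convolves with respect to \<open>+\<close> on the exponents; with words as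
  exponents it is the multiplication of the free algebra.\<close>

datatype word = Word (letters: "nat list")

instantiation word :: monoid_add
begin

definition zero_word :: word where
  "zero_word = Word []"

definition plus_word :: "word \<Rightarrow> word \<Rightarrow> word" where
  "plus_word v w = Word (letters v @ letters w)"

instance
  by standard (simp_all add: zero_word_def plus_word_def)

end

text \<open>\<open>free_alg N\<close> is the free algebra on the generators \<open>u\<^sub>1, \<dots>, u\<^bsub>N-1\<^esub>\<close>.\<close>

definition free_alg :: "nat \<Rightarrow> (word \<Rightarrow>\<^sub>0 'a::comm_ring_1) ring" where
  "free_alg N =
    \<lparr> carrier = {f. \<forall>w \<in> Poly_Mapping.keys f. set (letters w) \<subseteq> {1..<N}},
      monoid.mult = (*), one = 1, zero = 0, add = (+) \<rparr>"

definition free_gen :: "nat \<Rightarrow> (word \<Rightarrow>\<^sub>0 'a::comm_ring_1)" where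
  "free_gen i = Poly_Mapping.single (Word [i]) 1"

definition free_scalar :: "'a::comm_ring_1 \<Rightarrow> (word \<Rightarrow>\<^sub>0 'a)" where
  "free_scalar c = Poly_Mapping.single 0 c"


section \<open>The nilCoxeter algebra of \<open>S\<^sub>N\<close>\<close>

definition nilcoxeter_relators :: "nat \<Rightarrow> (word \<Rightarrow>\<^sub>0 'a::comm_ring_1) set" where
  "nilcoxeter_relators N =
      {free_gen i * free_gen i | i. i \<in> {1..<N}}
    \<union> {free_gen i * free_gen j - free_gen j * free_gen i | i j.
         i \<in> {1..<N} \<and> j \<in> {1..<N} \<and> \<bar>int i - int j\<bar> \<ge> 2}
    \<union> {free_gen i * free_gen (i + 1) * free_gen i
          - free_gen (i + 1) * free_gen i * free_gen (i + 1) | i.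
         i \<in> {1..<N} \<and> i + 1 \<in> {1..<N}}"

definition nilcoxeter_ideal :: "nat \<Rightarrow> (word \<Rightarrow>\<^sub>0 'a::comm_ring_1) set" where
  "nilcoxeter_ideal N = Idl\<^bsub>free_alg N\<^esub> (nilcoxeter_relators N)"

definition nilcoxeter :: "nat \<Rightarrow> (word \<Rightarrow>\<^sub>0 'a::comm_ring_1) set ring" where
  "nilcoxeter N = free_alg N Quot nilcoxeter_ideal N"

definition nc_class :: "nat \<Rightarrow> (word \<Rightarrow>\<^sub>0 'a::comm_ring_1) \<Rightarrow> (word \<Rightarrow>\<^sub>0 'a) set" where
  "nc_class N f = nilcoxeter_ideal N +>\<^bsub>free_alg N\<^esub> f"

definition nc_gen :: "nat \<Rightarrow> nat \<Rightarrow> (word \<Rightarrow>\<^sub>0 'a::comm_ring_1) set" where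
  "nc_gen N i = nc_class N (free_gen i)"

definition nc_scalar :: "nat \<Rightarrow> 'a::comm_ring_1 \<Rightarrow> (word \<Rightarrow>\<^sub>0 'a) set" where
  "nc_scalar N c = nc_class N (free_scalar c)"

definition nc_smult ::
  "nat \<Rightarrow> 'a::comm_ring_1 \<Rightarrow> (word \<Rightarrow>\<^sub>0 'a) set \<Rightarrow> (word \<Rightarrow>\<^sub>0 'a) set" where
  "nc_smult N c x = nc_scalar N c \<otimes>\<^bsub>nilcoxeter N\<^esub> x"

text \<open>The product of a list of elements, from left to right.\<close>

definition nc_prod :: "nat \<Rightarrow> (word \<Rightarrow>\<^sub>0 'a::comm_ring_1) set list \<Rightarrow> (word \<Rightarrow>\<^sub>0 'a) set" where
  "nc_prod N xs = foldr (\<otimes>\<^bsub>nilcoxeter N\<^esub>) xs \<one>\<^bsub>nilcoxeter N\<^esub>"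


section \<open>The basis indexed by permutations\<close>

text \<open>\<open>S\<^sub>N\<close> is the set of \<open>w :: nat \<Rightarrow> nat\<close> with \<open>w permutes {1..N}\<close>.\<close>

definition word_perm :: "nat list \<Rightarrow> nat \<Rightarrow> nat" where
  "word_perm a = foldr (\<lambda>i w. Transposition.transpose i (i + 1) \<circ> w) a id"

definition reduced_word :: "nat \<Rightarrow> nat list \<Rightarrow> (nat \<Rightarrow> nat) \<Rightarrow> bool" where
  "reduced_word N a w \<longleftrightarrow>
     set a \<subseteq> {1..<N} \<and> word_perm a = w \<and>
     (\<forall>b. set b \<subseteq> {1..<N} \<and> word_perm b = w \<longrightarrow> length a \<le> length b)"

text \<open>By Matsumoto's theorem the following element does not depend on the reduced word chosen,
  and these elements form a basis, so that the coefficient family in \<open>nc_coeff\<close> exists and is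
  unique.\<close>

definition nc_basis :: "nat \<Rightarrow> (nat \<Rightarrow> nat) \<Rightarrow> (word \<Rightarrow>\<^sub>0 'a::comm_ring_1) set" where
  "nc_basis N w = nc_prod N (map (nc_gen N) (SOME a. reduced_word N a w))"

definition nc_coeff :: "nat \<Rightarrow> (word \<Rightarrow>\<^sub>0 'a::comm_ring_1) set \<Rightarrow> (nat \<Rightarrow> nat) \<Rightarrow> 'a" where
  "nc_coeff N \<xi> =
     (THE c. (\<forall>v. \<not> v permutes {1..N} \<longrightarrow> c v = 0) \<and>
             \<xi> = (\<Oplus>\<^bsub>nilcoxeter N\<^esub>v\<in>{v. v permutes {1..N}}. nc_smult N (c v) (nc_basis N v)))"


section \<open>The polynomial \<open>\<SS>\<close> of \<open>1\<^sub>m \<times> \<varpi>\<^sub>0\<close>\<close>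

text \<open>\<open>A_elt N i t = (1 + t u\<^bsub>N-1\<^esub>) (1 + t u\<^bsub>N-2\<^esub>) \<dots> (1 + t u\<^sub>i)\<close>\<close>

definition A_elt :: "nat \<Rightarrow> nat \<Rightarrow> 'a::comm_ring_1 \<Rightarrow> (word \<Rightarrow>\<^sub>0 'a) set" where
  "A_elt N i t =
     nc_prod N (map (\<lambda>j. \<one>\<^bsub>nilcoxeter N\<^esub> \<oplus>\<^bsub>nilcoxeter N\<^esub> nc_smult N t (nc_gen N j)) (rev [i..<N]))"

definition A_tilde_elt :: "nat \<Rightarrow> nat \<Rightarrow> 'a::comm_ring_1 \<Rightarrow> (word \<Rightarrow>\<^sub>0 'a) set" where
  "A_tilde_elt N i t = inv\<^bsub>nilcoxeter N\<^esub> (A_elt N i t)"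

text \<open>Sequences of variables are indexed from 1; the value at 0 is never used.\<close>

definition schubert_tilde ::
  "nat \<Rightarrow> nat \<Rightarrow> (nat \<Rightarrow> 'a::comm_ring_1) \<Rightarrow> (nat \<Rightarrow> 'a) \<Rightarrow> (nat \<Rightarrow> 'a) \<Rightarrow> (word \<Rightarrow>\<^sub>0 'a) set" where
  "schubert_tilde m n \<omega> y z =
     nc_prod (m + n)
       (map (\<lambda>k. A_elt (m + n) k (\<omega> k)) [1..<m + 1]
        @ map (\<lambda>k. A_elt (m + n) (m + k) (y k)) [1..<n]
        @ map (\<lambda>k. A_tilde_elt (m + n) (m + k) (z k)) (rev [1..<n]))"

definition longest_perm :: "nat \<Rightarrow> nat \<Rightarrow> nat" where
  "longest_perm n j = (if j \<in> {1..n} then n + 1 - j else j)"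

definition shift_perm :: "nat \<Rightarrow> (nat \<Rightarrow> nat) \<Rightarrow> nat \<Rightarrow> nat" where
  "shift_perm m w j = (if j \<le> m then j else m + w (j - m))"

definition schubert_tilde_longest ::
  "nat \<Rightarrow> nat \<Rightarrow> (nat \<Rightarrow> 'a::comm_ring_1) \<Rightarrow> (nat \<Rightarrow> 'a) \<Rightarrow> (nat \<Rightarrow> 'a) \<Rightarrow> 'a" where
  "schubert_tilde_longest m n \<omega> y z =
     nc_coeff (m + n) (schubert_tilde m n \<omega> y z) (shift_perm m (longest_perm n))"


section \<open>Flagged Schur polynomials\<close>

text \<open>\<open>complete_sym p [x\<^sub>1, \<dots>, x\<^sub>k]\<close> is the sum of all monomials of degree \<open>p\<close> in the \<open>x\<^sub>i\<close>.\<close>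

definition complete_sym :: "int \<Rightarrow> 'a::comm_ring_1 list \<Rightarrow> 'a" where
  "complete_sym p xs =
     (if p < 0 then 0
      else \<Sum>e \<in> {e :: nat list. length e = length xs \<and> sum_list e = nat p}.
             \<Prod>i<length xs. xs ! i ^ (e ! i))"

definition omega_plus :: "nat \<Rightarrow> (nat \<Rightarrow> 'a) \<Rightarrow> (nat \<Rightarrow> 'a) \<Rightarrow> nat \<Rightarrow> 'a" where
  "omega_plus m \<omega> y k = (if k \<le> m then \<omega> k else y (k - m))"

text \<open>\<open>S\<^sub>\<lambda>\<^bsup>(\<phi>,\<psi>)\<^esup>(h(X,-Z))\<close>: the entry in row \<open>i\<close>, column \<open>j\<close> is \<open>h\<close> of degree \<open>\<lambda>\<^sub>i + j - i\<close> in
  \<open>x\<^sub>1, \<dots>, x\<^bsub>\<phi>\<^sub>i\<^esub>, -z\<^sub>1, \<dots>, -z\<^bsub>\<psi>\<^sub>i\<^esub>\<close>. This is the ordinary complete homogeneous polynomial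
  evaluated at \<open>-z\<^sub>k\<close>, not the supersymmetric one. Matrix and list indices start at 0.\<close>

definition flagged_schur ::
  "nat list \<Rightarrow> nat list \<Rightarrow> nat list \<Rightarrow> (nat \<Rightarrow> 'a::comm_ring_1) \<Rightarrow> (nat \<Rightarrow> 'a) \<Rightarrow> 'a" where
  "flagged_schur lam phi psi x z =
     det (mat (length lam) (length lam) (\<lambda>(i, j).
       complete_sym (int (lam ! i) + int j - int i)
         (map x [1..<phi ! i + 1] @ map (\<lambda>k. - z k) [1..<psi ! i + 1])))"

text \<open>\<open>delta k = (k, k - 1, \<dots>, 1)\<close> and \<open>delta_vee k m = (m + 1, \<dots>, m + k)\<close>\<close>

definition delta :: "nat \<Rightarrow> nat list" where
  "delta k = rev [1..<k + 1]"

definition delta_vee :: "nat \<Rightarrow> nat \<Rightarrow> nat list" where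
  "delta_vee k m = [m + 1..<m + k + 1]"

end

theory Submission
  imports Defs "HOL-Computational_Algebra.Formal_Power_Series"
begin

text \<open>Put \<open>N = m + n\<close> and \<open>B\<^sub>k(x) = (1 + x u\<^sub>k) \<dots> (1 + x u\<^bsub>N-1\<^esub>)\<close>, so that the inverse of \<open>\<A>\<^sub>k(z)\<close> is \<open>B\<^sub>k(-z)\<close>. Replace
  \<open>-z\<^sub>1, -z\<^sub>2, \<dots>\<close> by elements \<open>t\<^sub>1, \<dots>, t\<^sub>n\<close> of the coefficient ring. The element whose coefficient is
  wanted becomes \<open>P \<xi>(t)\<close> with \<open>\<xi>(t) = B\<^bsub>N-1\<^esub>(t\<^bsub>n-1\<^esub>) \<dots> B\<^bsub>m+1\<^esub>(t\<^sub>1)\<close>, where \<open>P\<close> is the product of the factors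
  \<open>\<A>\<^sub>k\<close> in the \<open>\<omega>\<close> and the \<open>y\<close>. Let \<open>L\<close> be the coefficient of \<open>1\<^sub>m \<times> \<varpi>\<^sub>0\<close>.

  By the Yang--Baxter equation, multiplying \<open>\<xi>(t)\<close> on the left by \<open>1 + (t\<^bsub>k+1\<^esub> - t\<^sub>k) u\<^bsub>m+k\<^esub>\<close> exchanges \<open>t\<^sub>k\<close> and
  \<open>t\<^bsub>k+1\<^esub>\<close> (\<open>stair_exchange\<close>). Therefore \<open>L(P u\<^bsub>m+k\<^esub> \<xi>(t))\<close> is the divided difference of \<open>L(P \<xi>(t))\<close> in
  \<open>t\<^sub>k, t\<^bsub>k+1\<^esub>\<close>, for every \<open>P\<close>: the value for \<open>P (1 + x u\<^bsub>m+k\<^esub>)\<close> follows from the values for \<open>P\<close> at \<open>t\<close> and at the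
  transposed \<open>t\<close>, as soon as \<open>t\<^bsub>k+1\<^esub> - t\<^sub>k\<close> is not a zero divisor.

  The claim \<open>L(P \<xi>(t)) = det (h\<^bsub>n-2i+j\<^esub>(t\<^sub>1, \<dots>, t\<^sub>i, U\<^sub>i))\<close>, with an alphabet \<open>U\<^sub>i\<close> for each row, is now proved by
  multiplying the factors of \<open>P\<close> on one at a time. For \<open>P = 1\<close> and empty \<open>U\<^sub>i\<close> both sides are
  \<open>t\<^sub>1\<^bsup>n-1\<^esup> \<dots> t\<^bsub>n-1\<^esub>\<close>: only the full word of \<open>\<xi>(t)\<close> is long enough for \<open>1\<^sub>m \<times> \<varpi>\<^sub>0\<close> (\<open>word_sum_stair\<close>), and the
  determinant is that of a triangular matrix (\<open>shifted_det_geo\<close>). Only row \<open>k\<close> of the determinant fails to be symmetric in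
  \<open>t\<^sub>k, t\<^bsub>k+1\<^esub>\<close>, and the divided difference of \<open>h\<^sub>p(t\<^sub>1, \<dots>, t\<^sub>k, U)\<close> is \<open>h\<^bsub>p-1\<^esub>(t\<^sub>1, \<dots>, t\<^bsub>k+1\<^esub>, U)\<close>. Since
  \<open>h\<^sub>p(t\<^sub>1, \<dots>, t\<^sub>k, U) + x h\<^bsub>p-1\<^esub>(t\<^sub>1, \<dots>, t\<^bsub>k+1\<^esub>, U)\<close> and \<open>h\<^sub>p(t\<^sub>1, \<dots>, t\<^sub>k, U, x)\<close> differ by
  \<open>x (x - t\<^bsub>k+1\<^esub>) h\<^bsub>p-2\<^esub>(t\<^sub>1, \<dots>, t\<^bsub>k+1\<^esub>, U, x)\<close>, where the last factor is an entry of row \<open>k + 1\<close> once \<open>x\<close> has been adjoined there, the factor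
  \<open>1 + x u\<^bsub>m+k\<^esub>\<close> adjoins \<open>x\<close> to row \<open>k\<close> (\<open>represents_lin\<close>). The letters of \<open>\<A>\<^bsub>m+k\<^esub>(x)\<close> come in descending order, so
  this factor adjoins \<open>x\<close> to all rows from \<open>k\<close> on. Factors with a letter at most \<open>m\<close> change nothing, because
  \<open>L\<close> can be computed from the words without such letters. At \<open>t\<^sub>i = -z\<^sub>i\<close> this is the assertion, and the differences
  of distinct variables are indeed not zero divisors (\<open>poly_var_diff_cancel\<close>), over any coefficient ring.

  The coefficient functional is handled on representatives in the free algebra, as the sum of the coefficients over a
  set of words that is closed under the defining relations (\<open>nil_closed\<close>). That it computes \<open>nc_coeff\<close> rests on
  Matsumoto's theorem and on the spanning property of the elements \<open>u\<^bsub>\<varpi>\<^esub>\<close>, both obtained from normal forms of words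
  (\<open>word_null_or_normal\<close>, \<open>nc_coeff_eq_word_sum\<close>).\<close>

section \<open>Words and linear functionals on the free algebra\<close>

definition u_word :: "nat list \<Rightarrow> (word \<Rightarrow>\<^sub>0 'a::comm_ring_1)" where
  "u_word a = Poly_Mapping.single (Word a) 1"

lemma plus_word_Word [simp]: "Word a + Word b = Word (a @ b)"
  by (simp add: plus_word_def)

lemma u_word_Nil: "u_word [] = 1"
  by (simp add: u_word_def flip: zero_word_def)

lemma u_word_append: "u_word (a @ b) = u_word a * u_word b"
  by (simp add: u_word_def mult_single)

lemma free_gen_eq_u_word: "free_gen i = u_word [i]"
  by (simp add: free_gen_def u_word_def)

lemma single_eq_scalar_word: "Poly_Mapping.single w c = free_scalar c * u_word (letters w)"
  by (simp add: free_scalar_def u_word_def mult_single)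

lemma lookup_scalar_mult: "Poly_Mapping.lookup (free_scalar c * f) w = c * Poly_Mapping.lookup f w"
  unfolding free_scalar_def mult_map_scale_conv_mult[symmetric]
  by (simp add: Poly_Mapping.map.rep_eq when_def)

lemma free_scalar_0 [simp]: "free_scalar 0 = 0"
  and free_scalar_1 [simp]: "free_scalar 1 = 1"
  and free_scalar_add: "free_scalar (c + d) = free_scalar c + free_scalar d"
  and free_scalar_minus: "free_scalar (- c) = - free_scalar c"
  and free_scalar_diff: "free_scalar (c - d) = free_scalar c - free_scalar d"
  and free_scalar_mult: "free_scalar (c * d) = free_scalar c * free_scalar d"
  by (simp_all add: free_scalar_def single_add single_diff single_uminus mult_single)

lemma poly_mapping_sum_single:
  "f = (\<Sum>k\<in>Poly_Mapping.keys f. Poly_Mapping.single k (Poly_Mapping.lookup f k))"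
proof (rule poly_mapping_eqI)
  fix l
  have "Poly_Mapping.lookup (\<Sum>k\<in>Poly_Mapping.keys f. Poly_Mapping.single k (Poly_Mapping.lookup f k)) l
      = (\<Sum>k\<in>Poly_Mapping.keys f. if k = l then Poly_Mapping.lookup f k else 0)"
    by (auto simp: lookup_sum lookup_single when_def intro!: sum.cong)
  also have "\<dots> = Poly_Mapping.lookup f l"
    by (simp add: sum.delta in_keys_iff)
  finally show "Poly_Mapping.lookup f l = Poly_Mapping.lookup
      (\<Sum>k\<in>Poly_Mapping.keys f. Poly_Mapping.single k (Poly_Mapping.lookup f k)) l"
    by simp
qed

lemma free_alg_expand:
  "f = (\<Sum>w\<in>Poly_Mapping.keys f. free_scalar (Poly_Mapping.lookup f w) * u_word (letters w))"
  using poly_mapping_sum_single[of f] by (simp add: single_eq_scalar_word)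

lemma free_alg_induct [case_names zero add word]:
  assumes "P 0" and "\<And>f g. P f \<Longrightarrow> P g \<Longrightarrow> P (f + g)" and "\<And>c a. P (free_scalar c * u_word a)"
  shows "P f"
proof -
  have "P (\<Sum>w\<in>A. free_scalar (Poly_Mapping.lookup f w) * u_word (letters w))" if "finite A" for A
    using that by induction (auto simp: assms)
  then have "P (\<Sum>w\<in>Poly_Mapping.keys f. free_scalar (Poly_Mapping.lookup f w) * u_word (letters w))"
    by simp
  then show ?thesis
    by (simp only: free_alg_expand[symmetric])
qed

text \<open>The scalars are central because the coefficient ring is commutative.\<close>

lemma free_scalar_comm: "f * free_scalar c = free_scalar c * f"
proof (induction f rule: free_alg_induct)
  case (word d a)
  then show ?case
    by (simp add: free_scalar_def u_word_def mult_single mult.commute zero_word_def)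
qed (simp_all add: distrib_left distrib_right)

lemma free_scalar_left_comm: "f * (free_scalar c * g) = free_scalar c * (f * g)"
  by (simp add: free_scalar_comm flip: mult.assoc)

definition word_sum :: "nat list set \<Rightarrow> (word \<Rightarrow>\<^sub>0 'a::comm_ring_1) \<Rightarrow> 'a" where
  "word_sum S f = (\<Sum>w \<in> Poly_Mapping.keys f. if letters w \<in> S then Poly_Mapping.lookup f w else 0)"

lemma word_sum_superset:
  assumes "finite A" "Poly_Mapping.keys f \<subseteq> A"
  shows "word_sum S f = (\<Sum>w \<in> A. if letters w \<in> S then Poly_Mapping.lookup f w else 0)"
  unfolding word_sum_def using assms
  by (intro sum.mono_neutral_left) (auto simp: in_keys_iff)

lemma word_sum_0 [simp]: "word_sum S 0 = 0"
  by (simp add: word_sum_def)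

lemma word_sum_add: "word_sum S (f + g) = word_sum S f + word_sum S g"
proof -
  let ?A = "Poly_Mapping.keys f \<union> Poly_Mapping.keys g"
  have "Poly_Mapping.keys (f + g) \<subseteq> ?A"
    by (rule keys_add)
  then have "word_sum S (f + g) = (\<Sum>w \<in> ?A. if letters w \<in> S then Poly_Mapping.lookup (f + g) w else 0)"
    by (intro word_sum_superset) auto
  also have "\<dots> = word_sum S f + word_sum S g"
    by (subst (1 2) word_sum_superset[of ?A])
       (auto simp: lookup_add simp flip: sum.distrib intro!: sum.cong)
  finally show ?thesis .
qed

lemma word_sum_scalar: "word_sum S (free_scalar c * f) = c * word_sum S f"
proof -
  have "Poly_Mapping.keys (free_scalar c * f) \<subseteq> Poly_Mapping.keys f"
    by (auto simp: in_keys_iff lookup_scalar_mult)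
  then have "word_sum S (free_scalar c * f)
    = (\<Sum>w \<in> Poly_Mapping.keys f. if letters w \<in> S then Poly_Mapping.lookup (free_scalar c * f) w else 0)"
    by (intro word_sum_superset) auto
  then show ?thesis
    by (auto simp: word_sum_def lookup_scalar_mult sum_distrib_left intro!: sum.cong)
qed

lemma word_sum_uminus: "word_sum S (- f) = - word_sum S f"
  using word_sum_scalar[of S "-1" f] by (simp add: free_scalar_minus)

lemma word_sum_diff: "word_sum S (f - g) = word_sum S f - word_sum S g"
  using word_sum_add[of S f "- g"] by (simp add: word_sum_uminus)

lemma word_sum_sum: "word_sum S (\<Sum>i\<in>I. f i) = (\<Sum>i\<in>I. word_sum S (f i))"
  by (induction I rule: infinite_finite_induct) (auto simp: word_sum_add)

lemma word_sum_u_word: "word_sum S (u_word a) = (if a \<in> S then 1 else 0)"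
  by (simp add: word_sum_def u_word_def)

lemmas word_sum_simps = word_sum_add word_sum_scalar word_sum_uminus word_sum_diff word_sum_sum
  word_sum_u_word

lemma word_sum_u_word_mult: "word_sum S (u_word p * f) = word_sum {a. p @ a \<in> S} f"
proof (induction f rule: free_alg_induct)
  case (word c a)
  then show ?case
    by (simp add: free_scalar_left_comm word_sum_simps flip: u_word_append)
qed (simp_all add: distrib_left word_sum_simps)

text \<open>By bilinearity in \<open>x\<close> and \<open>y\<close>; this turns conditions on words into conditions on ideals.\<close>

lemma word_sum_two_sided_eq_0:
  assumes "\<And>p q. word_sum S (u_word p * r * u_word q) = 0"
  shows "word_sum S (x * r * y) = 0"
proof -
  have left: "word_sum S (u_word p * r * y) = 0" for p
  proof (induction y rule: free_alg_induct)
    case (word c a)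
    then show ?case
      by (simp add: free_scalar_left_comm word_sum_simps assms)
  qed (simp_all add: distrib_left word_sum_simps)
  show ?thesis
  proof (induction x rule: free_alg_induct)
    case (word c a)
    then show ?case
      by (simp add: mult.assoc word_sum_simps) (simp add: left flip: mult.assoc)
  qed (simp_all add: distrib_right word_sum_simps)
qed


section \<open>The nilCoxeter algebra as a quotient of the free algebra\<close>

lemma free_alg_simps [simp]:
  "f \<otimes>\<^bsub>free_alg N\<^esub> g = f * g" "f \<oplus>\<^bsub>free_alg N\<^esub> g = f + g"
  "\<one>\<^bsub>free_alg N\<^esub> = 1" "\<zero>\<^bsub>free_alg N\<^esub> = 0"
  by (simp_all add: free_alg_def)

lemma free_alg_carrier:
  "f \<in> carrier (free_alg N) \<longleftrightarrow> (\<forall>w \<in> Poly_Mapping.keys f. set (letters w) \<subseteq> {1..<N})"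
  by (simp add: free_alg_def)

lemma free_alg_add: "f \<in> carrier (free_alg N) \<Longrightarrow> g \<in> carrier (free_alg N) \<Longrightarrow> f + g \<in> carrier (free_alg N)"
  using keys_add[of f g] by (auto simp: free_alg_carrier)

lemma free_alg_mult:
  assumes "f \<in> carrier (free_alg N)" "g \<in> carrier (free_alg N)"
  shows "f * g \<in> carrier (free_alg N)"
  unfolding free_alg_carrier
proof
  fix w assume "w \<in> Poly_Mapping.keys (f * g)"
  then obtain u v where "w = u + v" "u \<in> Poly_Mapping.keys f" "v \<in> Poly_Mapping.keys g"
    using keys_mult[of f g] by blast
  then show "set (letters w) \<subseteq> {1..<N}"
    using assms by (auto simp: free_alg_carrier plus_word_def)
qed

lemma free_alg_word: "set a \<subseteq> {1..<N} \<Longrightarrow> u_word a \<in> carrier (free_alg N)"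
  by (auto simp: free_alg_carrier u_word_def)

lemma free_alg_gen: "1 \<le> i \<Longrightarrow> i < N \<Longrightarrow> free_gen i \<in> carrier (free_alg N)"
  by (auto simp: free_gen_eq_u_word intro!: free_alg_word)

lemma free_alg_scalar: "free_scalar c \<in> carrier (free_alg N)"
  by (auto simp: free_alg_carrier free_scalar_def zero_word_def)

lemma free_alg_0: "0 \<in> carrier (free_alg N)"
  and free_alg_1: "1 \<in> carrier (free_alg N)"
  using free_alg_scalar[of 0 N] free_alg_scalar[of 1 N] by simp_all

lemma free_alg_uminus: "f \<in> carrier (free_alg N) \<Longrightarrow> - f \<in> carrier (free_alg N)"
  using free_alg_mult[OF free_alg_scalar[of "-1"], of f] by (simp add: free_scalar_minus)

lemma free_alg_diff: "f \<in> carrier (free_alg N) \<Longrightarrow> g \<in> carrier (free_alg N) \<Longrightarrow> f - g \<in> carrier (free_alg N)"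
  using free_alg_add[OF _ free_alg_uminus] by fastforce

lemma free_alg_prod_list: "set fs \<subseteq> carrier (free_alg N) \<Longrightarrow> prod_list fs \<in> carrier (free_alg N)"
  by (induction fs) (auto intro: free_alg_1 free_alg_mult)

lemma free_alg_sum: "(\<And>i. i \<in> I \<Longrightarrow> f i \<in> carrier (free_alg N)) \<Longrightarrow> sum f I \<in> carrier (free_alg N)"
  by (induction I rule: infinite_finite_induct) (auto intro: free_alg_0 free_alg_add)

lemmas free_alg_closed = free_alg_add free_alg_mult free_alg_word free_alg_gen free_alg_scalar
  free_alg_0 free_alg_1 free_alg_uminus free_alg_diff free_alg_prod_list free_alg_sum

lemma ring_free_alg: "ring (free_alg N :: (word \<Rightarrow>\<^sub>0 'a::comm_ring_1) ring)"
proof (rule ringI)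
  show "abelian_group (free_alg N :: (word \<Rightarrow>\<^sub>0 'a) ring)"
  proof (rule abelian_groupI)
    fix x :: "word \<Rightarrow>\<^sub>0 'a" assume "x \<in> carrier (free_alg N)"
    then show "\<exists>y\<in>carrier (free_alg N). y \<oplus>\<^bsub>free_alg N\<^esub> x = \<zero>\<^bsub>free_alg N\<^esub>"
      by (intro bexI[of _ "- x"]) (auto intro: free_alg_uminus)
  qed (auto intro: free_alg_closed)
  show "Group.monoid (free_alg N :: (word \<Rightarrow>\<^sub>0 'a) ring)"
    by (rule monoidI) (auto intro: free_alg_closed simp: mult.assoc)
qed (auto simp: algebra_simps)

lemma nilcoxeter_relators_carrier: "nilcoxeter_relators N \<subseteq> carrier (free_alg N)"
  unfolding nilcoxeter_relators_def
  by (auto intro!: free_alg_diff free_alg_mult free_alg_gen)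

lemma ideal_nilcoxeter: "ideal (nilcoxeter_ideal N) (free_alg N)"
  unfolding nilcoxeter_ideal_def
  by (rule ring.genideal_ideal[OF ring_free_alg nilcoxeter_relators_carrier])

lemma ring_nilcoxeter: "ring (nilcoxeter N)"
  unfolding nilcoxeter_def by (rule ideal.quotient_is_ring[OF ideal_nilcoxeter])

lemma nc_class_hom: "ring_hom_ring (free_alg N) (nilcoxeter N) (nc_class N)"
  using ideal.rcos_ring_hom_ring[OF ideal_nilcoxeter, of N]
  by (simp add: nilcoxeter_def nc_class_def[abs_def])

text \<open>Equality of classes in the nilCoxeter algebra, expressed between representatives, so that calculations can use the
  type class operations of the free algebra instead of those of the quotient record.\<close>

definition nc_cong :: "nat \<Rightarrow> (word \<Rightarrow>\<^sub>0 'a::comm_ring_1) \<Rightarrow> (word \<Rightarrow>\<^sub>0 'a) \<Rightarrow> bool" where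
  "nc_cong N f g \<longleftrightarrow> f \<in> carrier (free_alg N) \<and> g \<in> carrier (free_alg N) \<and> f - g \<in> nilcoxeter_ideal N"

lemma minus_free_alg: 
  assumes "f \<in> carrier (free_alg N)" "g \<in> carrier (free_alg N)"
  shows "f \<ominus>\<^bsub>free_alg N\<^esub> g = f - g"
proof -
  interpret ring "free_alg N" by (rule ring_free_alg)
  have "\<ominus>\<^bsub>free_alg N\<^esub> g = - g"
    using assms free_alg_uminus[of g N] by (intro minus_equality) auto
  then show ?thesis by (simp add: a_minus_def)
qed

lemma nc_class_eq_iff:
  assumes "f \<in> carrier (free_alg N)" "g \<in> carrier (free_alg N)"
  shows "nc_class N f = nc_class N g \<longleftrightarrow> nc_cong N f g"
proof -
  interpret ideal "nilcoxeter_ideal N" "free_alg N" by (rule ideal_nilcoxeter)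
  have "f \<in> nilcoxeter_ideal N +>\<^bsub>free_alg N\<^esub> g \<longleftrightarrow> f - g \<in> nilcoxeter_ideal N"
    using assms a_rcos_module_minus[OF ring_free_alg, of g f] minus_free_alg by metis
  then show ?thesis
    using assms a_repr_independence' a_rcos_self
    unfolding nc_class_def nc_cong_def by metis
qed

lemma nc_cong_refl: "f \<in> carrier (free_alg N) \<Longrightarrow> nc_cong N f f"
  using nc_class_eq_iff[of f N f] by simp

lemma nc_cong_carrier:
  assumes "nc_cong N f g"
  shows "f \<in> carrier (free_alg N)" "g \<in> carrier (free_alg N)"
  using assms by (auto simp: nc_cong_def)

lemma nc_cong_sym: "nc_cong N f g \<Longrightarrow> nc_cong N g f"
  by (metis nc_class_eq_iff nc_cong_carrier)

lemma nc_cong_trans [trans]: "nc_cong N f g \<Longrightarrow> nc_cong N g h \<Longrightarrow> nc_cong N f h"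
  by (metis nc_class_eq_iff nc_cong_carrier)

lemma nc_class_mult:
  "f \<in> carrier (free_alg N) \<Longrightarrow> g \<in> carrier (free_alg N) \<Longrightarrow>
   nc_class N f \<otimes>\<^bsub>nilcoxeter N\<^esub> nc_class N g = nc_class N (f * g)"
  using ring_hom_mult[OF ring_hom_ring.homh[OF nc_class_hom], of f N g] by simp

lemma nc_class_add:
  "f \<in> carrier (free_alg N) \<Longrightarrow> g \<in> carrier (free_alg N) \<Longrightarrow>
   nc_class N f \<oplus>\<^bsub>nilcoxeter N\<^esub> nc_class N g = nc_class N (f + g)"
  using ring_hom_add[OF ring_hom_ring.homh[OF nc_class_hom], of f N g] by simp

lemma nc_class_one: "\<one>\<^bsub>nilcoxeter N\<^esub> = nc_class N 1"
  using ring_hom_one[OF ring_hom_ring.homh[OF nc_class_hom], of N, symmetric] by simp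

lemma nc_class_zero: "\<zero>\<^bsub>nilcoxeter N\<^esub> = nc_class N 0"
proof -
  interpret ring_hom_ring "free_alg N" "nilcoxeter N" "nc_class N" by (rule nc_class_hom)
  show ?thesis using hom_zero[symmetric] by simp
qed

lemma nc_class_carrier: "f \<in> carrier (free_alg N) \<Longrightarrow> nc_class N f \<in> carrier (nilcoxeter N)"
  using ring_hom_closed[OF ring_hom_ring.homh[OF nc_class_hom], of f N] .

lemma nc_cong_mult:
  assumes "nc_cong N f f'" "nc_cong N g g'"
  shows "nc_cong N (f * g) (f' * g')"
proof -
  note c = nc_cong_carrier[OF assms(1)] nc_cong_carrier[OF assms(2)]
  have "nc_class N f = nc_class N f'" "nc_class N g = nc_class N g'"
    using assms c by (simp_all add: nc_class_eq_iff)
  then have "nc_class N (f * g) = nc_class N (f' * g')"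
    using c by (simp flip: nc_class_mult)
  then show ?thesis
    using c by (simp add: nc_class_eq_iff free_alg_mult)
qed

lemma nc_cong_add:
  assumes "nc_cong N f f'" "nc_cong N g g'"
  shows "nc_cong N (f + g) (f' + g')"
proof -
  note c = nc_cong_carrier[OF assms(1)] nc_cong_carrier[OF assms(2)]
  have "nc_class N f = nc_class N f'" "nc_class N g = nc_class N g'"
    using assms c by (simp_all add: nc_class_eq_iff)
  then have "nc_class N (f + g) = nc_class N (f' + g')"
    using c by (simp flip: nc_class_add)
  then show ?thesis
    using c by (simp add: nc_class_eq_iff free_alg_add)
qed

lemma nc_prod_class:
  "set fs \<subseteq> carrier (free_alg N) \<Longrightarrow> nc_prod N (map (nc_class N) fs) = nc_class N (prod_list fs)"
  unfolding nc_prod_def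
  by (induction fs) (auto simp: nc_class_one nc_class_mult free_alg_prod_list)

lemma nc_finsum_class:
  assumes "finite I" "\<And>i. i \<in> I \<Longrightarrow> f i \<in> carrier (free_alg N)"
  shows "(\<Oplus>\<^bsub>nilcoxeter N\<^esub>i\<in>I. nc_class N (f i)) = nc_class N (\<Sum>i\<in>I. f i)"
proof -
  interpret ring "nilcoxeter N" by (rule ring_nilcoxeter)
  show ?thesis using assms
  proof (induction I)
    case empty
    then show ?case by (simp add: nc_class_zero)
  next
    case (insert i I)
    have "(\<Oplus>\<^bsub>nilcoxeter N\<^esub>i\<in>insert i I. nc_class N (f i))
        = nc_class N (f i) \<oplus>\<^bsub>nilcoxeter N\<^esub> (\<Oplus>\<^bsub>nilcoxeter N\<^esub>i\<in>I. nc_class N (f i))"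
      using insert.hyps insert.prems by (intro finsum_insert) (auto intro!: nc_class_carrier)
    with insert show ?case
      by (simp add: nc_class_add free_alg_sum)
  qed
qed

lemma nc_cong_relator: "r \<in> nilcoxeter_relators N \<Longrightarrow> r \<in> nilcoxeter_ideal N"
  unfolding nilcoxeter_ideal_def
  using ring.genideal_self[OF ring_free_alg nilcoxeter_relators_carrier, of N] by blast

lemma nc_cong_square:
  assumes "i \<in> {1..<N}"
  shows "nc_cong N (free_gen i * free_gen i) 0"
proof -
  have "free_gen i * free_gen i \<in> nilcoxeter_ideal N"
    using assms by (intro nc_cong_relator) (auto simp: nilcoxeter_relators_def)
  with assms show ?thesis
    by (auto simp: nc_cong_def intro!: free_alg_closed)
qed

lemma nc_cong_commute:
  assumes "i \<in> {1..<N}" "j \<in> {1..<N}" "\<bar>int i - int j\<bar> \<ge> 2"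
  shows "nc_cong N (free_gen i * free_gen j) (free_gen j * free_gen i)"
proof -
  have "free_gen i * free_gen j - free_gen j * free_gen i \<in> nilcoxeter_ideal N"
    using assms by (intro nc_cong_relator) (auto simp: nilcoxeter_relators_def)
  with assms show ?thesis
    by (auto simp: nc_cong_def intro!: free_alg_closed)
qed

lemma nc_cong_braid:
  assumes "i \<in> {1..<N}" "i + 1 \<in> {1..<N}"
  shows "nc_cong N (free_gen i * free_gen (i + 1) * free_gen i)
                   (free_gen (i + 1) * free_gen i * free_gen (i + 1))"
proof -
  have "free_gen i * free_gen (i + 1) * free_gen i
      - free_gen (i + 1) * free_gen i * free_gen (i + 1) \<in> nilcoxeter_ideal N"
    using assms unfolding nilcoxeter_relators_def by (intro nc_cong_relator) (auto simp: nilcoxeter_relators_def)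
  with assms show ?thesis
    by (auto simp: nc_cong_def intro!: free_alg_closed)
qed

text \<open>These are the sets of words that contain no word with two equal adjacent letters and are unions of classes of commutation and braid
  moves. They are exactly what makes the sum of coefficients over the set descend to the quotient.\<close>

definition nil_closed :: "nat list set \<Rightarrow> bool" where
  "nil_closed S \<longleftrightarrow>
     (\<forall>p q i. p @ [i, i] @ q \<notin> S) \<and>
     (\<forall>p q i j. \<bar>int i - int j\<bar> \<ge> 2 \<longrightarrow> (p @ [i, j] @ q \<in> S \<longleftrightarrow> p @ [j, i] @ q \<in> S)) \<and>
     (\<forall>p q i. p @ [i, i + 1, i] @ q \<in> S \<longleftrightarrow> p @ [i + 1, i, i + 1] @ q \<in> S)"

text \<open>The elements of the free algebra all of whose two-sided multiples have sum 0 form an ideal, and \<open>nil_closed\<close> says that it contains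
  the relators.\<close>

lemma word_sum_ideal:
  fixes f :: "word \<Rightarrow>\<^sub>0 'a::comm_ring_1"
  assumes S: "nil_closed S" and f: "f \<in> nilcoxeter_ideal N"
  shows "word_sum S f = 0"
proof -
  let ?J = "{f :: word \<Rightarrow>\<^sub>0 'a. f \<in> carrier (free_alg N) \<and> (\<forall>x y. word_sum S (x * f * y) = 0)}"
  interpret ring "free_alg N :: (word \<Rightarrow>\<^sub>0 'a) ring" by (rule ring_free_alg)
  have "ideal ?J (free_alg N)"
  proof (rule idealI)
    show "ring (free_alg N :: (word \<Rightarrow>\<^sub>0 'a) ring)"
      by (rule ring_free_alg)
    have inv: "\<ominus>\<^bsub>free_alg N\<^esub> f = - f" if "f \<in> carrier (free_alg N)" for f :: "word \<Rightarrow>\<^sub>0 'a"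
      using that free_alg_uminus[of f N] by (intro minus_equality) auto
    show "subgroup ?J (add_monoid (free_alg N))"
      by (rule add.subgroupI)
         (auto simp: inv distrib_left distrib_right word_sum_simps intro: free_alg_closed
            simp flip: a_inv_def)
  next
    fix f x :: "word \<Rightarrow>\<^sub>0 'a"
    assume f: "f \<in> ?J" and x: "x \<in> carrier (free_alg N)"
    have "word_sum S (a * (x * f) * b) = 0" "word_sum S (a * (f * x) * b) = 0" for a b
      using f by (simp_all add: mult.assoc) (simp_all flip: mult.assoc)
    with f x show "x \<otimes>\<^bsub>free_alg N\<^esub> f \<in> ?J" "f \<otimes>\<^bsub>free_alg N\<^esub> x \<in> ?J"
      by (auto intro: free_alg_mult)
  qed
  moreover have "nilcoxeter_relators N \<subseteq> ?J"
  proof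
    fix r :: "word \<Rightarrow>\<^sub>0 'a"
    assume r: "r \<in> nilcoxeter_relators N"
    have "word_sum S (u_word p * r * u_word q) = 0" for p q
    proof -
      from r consider (square) i where "r = u_word [i, i]"
        | (commute) i j where "\<bar>int i - int j\<bar> \<ge> 2" "r = u_word [i, j] - u_word [j, i]"
        | (braid) i where "r = u_word [i, i + 1, i] - u_word [i + 1, i, i + 1]"
        unfolding nilcoxeter_relators_def free_gen_eq_u_word
        by (auto simp flip: u_word_append)
      then show ?thesis
        using S unfolding nil_closed_def
        by cases (simp_all add: left_diff_distrib right_diff_distrib word_sum_simps flip: u_word_append)
    qed
    then have "word_sum S (x * r * y) = 0" for x y
      by (rule word_sum_two_sided_eq_0)
    with r nilcoxeter_relators_carrier show "r \<in> ?J"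
      by auto
  qed
  ultimately have "nilcoxeter_ideal N \<subseteq> ?J"
    unfolding nilcoxeter_ideal_def by (rule genideal_minimal)
  with f have "word_sum S (1 * f * 1) = 0"
    by blast
  then show ?thesis by simp
qed

lemma word_sum_cong: "nil_closed S \<Longrightarrow> nc_cong N f g \<Longrightarrow> word_sum S f = word_sum S g"
  using word_sum_ideal[of S "f - g" N] by (simp add: nc_cong_def word_sum_diff)

section \<open>Words and permutations\<close>

lemma word_perm_Nil [simp]: "word_perm [] = id"
  and word_perm_Cons: "word_perm (i # a) = Transposition.transpose i (i + 1) \<circ> word_perm a"
  by (simp_all add: word_perm_def)

lemma word_perm_append: "word_perm (a @ b) = word_perm a \<circ> word_perm b"
  by (induction a) (simp_all add: word_perm_Cons comp_assoc)

lemma word_perm_permutes: "set a \<subseteq> {1..<N} \<Longrightarrow> word_perm a permutes {1..N}"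
proof (induction a)
  case (Cons i a)
  then have "Transposition.transpose i (i + 1) permutes {1..N}"
    by (intro permutes_swap_id) auto
  with Cons show ?case
    unfolding word_perm_Cons by (intro permutes_compose) auto
next
  case Nil
  show ?case unfolding word_perm_Nil by (rule permutes_id)
qed

lemma bij_word_perm: "bij (word_perm a)"
proof (induction a)
  case Nil
  show ?case unfolding word_perm_Nil by (rule bij_id)
next
  case (Cons i a)
  then show ?case unfolding word_perm_Cons by (intro bij_comp bij_transpose)
qed

lemma word_perm_square: "word_perm [i, i] = id"
  by (simp add: word_perm_Cons)

lemma word_perm_commute:
  assumes "\<bar>int i - int j\<bar> \<ge> 2"
  shows "word_perm [i, j] = word_perm [j, i]"
  using assms by (auto simp: word_perm_Cons fun_eq_iff Transposition.transpose_def)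

lemma word_perm_braid: "word_perm [i, i + 1, i] = word_perm [i + 1, i, i + 1]"
  by (auto simp: word_perm_Cons fun_eq_iff Transposition.transpose_def)

definition perm_words :: "nat set \<Rightarrow> nat \<Rightarrow> (nat \<Rightarrow> nat) \<Rightarrow> nat list set" where
  "perm_words A l w = {a. set a \<subseteq> A \<and> word_perm a = w \<and> length a = l}"

text \<open>Commutation and braid moves preserve length and permutation, while deleting a pair of equal adjacent letters preserves the permutation
  and would give a word shorter than the minimum \<open>l\<close>.\<close>

lemma nil_closed_perm_words:
  assumes min: "\<And>b. set b \<subseteq> A \<Longrightarrow> word_perm b = w \<Longrightarrow> l \<le> length b"
  shows "nil_closed (perm_words A l w)"
  unfolding nil_closed_def
proof (intro conjI allI impI notI)
  fix p q i
  assume *: "p @ [i, i] @ q \<in> perm_words A l w"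
  have "word_perm (p @ [i, i] @ q) = word_perm (p @ q)"
    by (simp only: word_perm_append word_perm_square id_comp)
  with * have "l \<le> length (p @ q)"
    by (intro min) (auto simp: perm_words_def)
  with * show False
    by (simp add: perm_words_def)
next
  fix p q :: "nat list" and i j :: nat
  assume "\<bar>int i - int j\<bar> \<ge> 2"
  then have "word_perm (p @ [i, j] @ q) = word_perm (p @ [j, i] @ q)"
    by (simp only: word_perm_append word_perm_commute)
  then show "(p @ [i, j] @ q \<in> perm_words A l w) = (p @ [j, i] @ q \<in> perm_words A l w)"
    unfolding perm_words_def by auto
next
  fix p q :: "nat list" and i :: nat
  show "(p @ [i, i + 1, i] @ q \<in> perm_words A l w) = (p @ [i + 1, i, i + 1] @ q \<in> perm_words A l w)"
  proof -
    have "word_perm (p @ [i, i + 1, i] @ q) = word_perm (p @ [i + 1, i, i + 1] @ q)"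
      by (simp only: word_perm_append word_perm_braid)
    then show ?thesis
      unfolding perm_words_def by auto
  qed
qed

lemma reduced_word_perm_words:
  assumes "reduced_word N a w"
  shows "nil_closed (perm_words {1..<N} (length a) w)"
    and "reduced_word N b w \<longleftrightarrow> b \<in> perm_words {1..<N} (length a) w"
proof -
  show "nil_closed (perm_words {1..<N} (length a) w)"
    using assms by (intro nil_closed_perm_words) (auto simp: reduced_word_def)
  show "reduced_word N b w \<longleftrightarrow> b \<in> perm_words {1..<N} (length a) w"
    using assms unfolding reduced_word_def perm_words_def
    by (auto intro: antisym)
qed

section \<open>Normal forms and the basis theorem\<close>

text \<open>Concatenations of descending runs, the \<open>i\<close>-th of which is empty or starts with \<open>i\<close>. The run added last moves some position
  \<open>s\<close> to \<open>N + 1\<close>, so these words represent the coset decomposition of \<open>S\<^bsub>N+1\<^esub>\<close> over \<open>S\<^sub>N\<close>, iterated.\<close>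

primrec normal_words :: "nat \<Rightarrow> nat list set" where
  "normal_words 0 = {[]}"
| "normal_words (Suc N) = {a @ rev [s..<Suc N] | a s. a \<in> normal_words N \<and> s \<in> {1..Suc N}}"

lemma normal_words_SucI:
  "a \<in> normal_words N \<Longrightarrow> s \<in> {1..Suc N} \<Longrightarrow> a @ rev [s..<Suc N] \<in> normal_words (Suc N)"
  unfolding normal_words.simps by blast

lemma normal_words_letters: "a \<in> normal_words N \<Longrightarrow> set a \<subseteq> {1..<N}"
  by (induction N arbitrary: a) fastforce+

lemma word_perm_fixes: "set a \<subseteq> {1..<N} \<Longrightarrow> N < x \<Longrightarrow> word_perm a x = x"
  using permutes_not_in[OF word_perm_permutes] by fastforce

lemma word_perm_descending_run:
  assumes "s \<le> N"
  shows "word_perm (rev [s..<N]) s = N"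
  using assms
proof (induction N rule: dec_induct)
  case (step N)
  have "word_perm (rev [s..<Suc N]) s = Transposition.transpose N (N + 1) (word_perm (rev [s..<N]) s)"
    using step by (simp add: word_perm_Cons)
  with step show ?case by simp
qed simp

text \<open>The last run is determined by the position that the permutation sends to the largest point, and can then be cancelled.\<close>

lemma normal_words_inj:
  "a \<in> normal_words N \<Longrightarrow> b \<in> normal_words N \<Longrightarrow> word_perm a = word_perm b \<Longrightarrow> a = b"
proof (induction N arbitrary: a b)
  case (Suc N)
  from Suc.prems obtain a' s where a: "a = a' @ rev [s..<Suc N]" "a' \<in> normal_words N" "s \<in> {1..Suc N}"
    by auto
  from Suc.prems obtain b' t where b: "b = b' @ rev [t..<Suc N]" "b' \<in> normal_words N" "t \<in> {1..Suc N}"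
    by auto
  have top: "word_perm (c @ rev [r..<Suc N]) r = Suc N" if "c \<in> normal_words N" "r \<in> {1..Suc N}" for c r
    using that word_perm_descending_run[of r "Suc N"] word_perm_fixes[OF normal_words_letters, of c N "Suc N"]
    by (simp add: word_perm_append)
  have "word_perm a s = word_perm a t"
    using top a b Suc.prems(3) by metis
  then have st: "s = t"
    using bij_word_perm[of a] by (auto simp: bij_def dest: injD)
  have "word_perm a' \<circ> word_perm (rev [s..<Suc N]) = word_perm b' \<circ> word_perm (rev [s..<Suc N])"
    using Suc.prems(3) unfolding a b st word_perm_append .
  then have "word_perm a' = word_perm b'"
    using bij_word_perm[of "rev [s..<Suc N]"] by (metis bij_def surj_fun_eq comp_apply UNIV_I)
  with Suc.IH a b st show ?case by blast
qed simp

lemma normal_words_surj: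
  "v permutes {1..N} \<Longrightarrow> \<exists>a \<in> normal_words N. word_perm a = v"
proof (induction N arbitrary: v)
  case (Suc N)
  define s where "s = inv_into UNIV v (Suc N)"
  define c where "c = word_perm (rev [s..<Suc N])"
  have s: "s \<in> {1..Suc N}" "v s = Suc N"
    using Suc.prems permutes_in_image[OF permutes_inv[OF Suc.prems], of "Suc N"] permutes_inverses(1)[OF Suc.prems]
    by (auto simp: s_def)
  have c: "c permutes {1..Suc N}"
    unfolding c_def using s by (intro word_perm_permutes) auto
  have "c s = Suc N"
    unfolding c_def using s by (intro word_perm_descending_run) auto
  then have "(v \<circ> inv_into UNIV c) (Suc N) = Suc N"
    using s permutes_inverses(2)[OF c, of s] by simp
  moreover have "v \<circ> inv_into UNIV c permutes {1..Suc N}"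
    using c Suc.prems by (intro permutes_compose permutes_inv)
  ultimately have "v \<circ> inv_into UNIV c permutes {1..N}"
    by (rule_tac permutes_superset) (auto simp: le_Suc_eq)
  then obtain a where a: "a \<in> normal_words N" "word_perm a = v \<circ> inv_into UNIV c"
    using Suc.IH by blast
  have "word_perm (a @ rev [s..<Suc N]) = v \<circ> (inv_into UNIV c \<circ> c)"
    by (simp add: word_perm_append a c_def comp_assoc)
  also have "\<dots> = v"
    using permutes_inv_o(2)[OF c] by simp
  finally show ?case
    using a(1) s(1) by (auto simp del: upt_Suc)
qed simp

text \<open>The permutation has to be recorded as well, because a word that is not reduced has class 0 and its class no longer
  determines it. The coefficient type occurs only in the type of the algebra, hence the type argument.\<close>

definition word_equiv :: "'a::comm_ring_1 itself \<Rightarrow> nat \<Rightarrow> nat list \<Rightarrow> nat list \<Rightarrow> bool" where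
  "word_equiv T N a b \<longleftrightarrow> nc_cong N (u_word a :: word \<Rightarrow>\<^sub>0 'a) (u_word b) \<and> word_perm a = word_perm b"

lemma word_equiv_refl: "set a \<subseteq> {1..<N} \<Longrightarrow> word_equiv T N a a"
  by (simp add: word_equiv_def nc_cong_refl free_alg_word)

lemma word_equiv_trans [trans]: "word_equiv T N a b \<Longrightarrow> word_equiv T N b c \<Longrightarrow> word_equiv T N a c"
  unfolding word_equiv_def using nc_cong_trans by metis

lemma word_equiv_append:
  "word_equiv T N a a' \<Longrightarrow> word_equiv T N b b' \<Longrightarrow> word_equiv T N (a @ b) (a' @ b')"
  by (auto simp: word_equiv_def u_word_append word_perm_append intro: nc_cong_mult)

lemma word_equiv_commute:
  assumes "i \<in> {1..<N}" "j \<in> {1..<N}" "\<bar>int i - int j\<bar> \<ge> 2"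
  shows "word_equiv T N [i, j] [j, i]"
  using nc_cong_commute[OF assms] word_perm_commute[OF assms(3)]
  by (simp add: word_equiv_def free_gen_eq_u_word flip: u_word_append)

lemma word_equiv_braid:
  assumes "i \<in> {1..<N}" "i + 1 \<in> {1..<N}"
  shows "word_equiv T N [i + 1, i, i + 1] [i, i + 1, i]"
  using nc_cong_sym[OF nc_cong_braid[OF assms]] word_perm_braid[of i]
  by (simp add: word_equiv_def free_gen_eq_u_word flip: u_word_append)

lemma word_equiv_commute_past:
  assumes "j \<in> {1..<N}" "set b \<subseteq> {1..<N}" "\<forall>i \<in> set b. \<bar>int i - int j\<bar> \<ge> 2"
  shows "word_equiv T N (b @ [j]) (j # b)"
  using assms(2,3)
proof (induction b)
  case Nil
  with assms(1) show ?case by (simp add: word_equiv_refl)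
next
  case (Cons i b)
  have "word_equiv T N ([i] @ (b @ [j])) ([i] @ (j # b))"
    using Cons by (intro word_equiv_append word_equiv_refl) auto
  also have "[i] @ (j # b) = [i, j] @ b" by simp
  also have "word_equiv T N ([i, j] @ b) ([j, i] @ b)" 
    using Cons assms(1) by (intro word_equiv_append word_equiv_refl word_equiv_commute) auto
  finally show ?case by simp
qed

definition word_null :: "'a::comm_ring_1 itself \<Rightarrow> nat \<Rightarrow> nat list \<Rightarrow> bool" where
  "word_null T N a \<longleftrightarrow> nc_cong N (u_word a :: word \<Rightarrow>\<^sub>0 'a) 0"

lemma word_null_append:
  assumes "word_null T N b" "set a \<subseteq> {1..<N}" "set c \<subseteq> {1..<N}"
  shows "word_null T N (a @ b @ c)"
proof -
  have "nc_cong N (u_word a * (u_word b * u_word c)) (u_word a * (0 * u_word c) :: word \<Rightarrow>\<^sub>0 'a)"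
    using assms by (intro nc_cong_mult nc_cong_refl free_alg_word) (auto simp: word_null_def)
  then show ?thesis
    by (simp add: word_null_def u_word_append)
qed

lemma word_null_square: "i \<in> {1..<N} \<Longrightarrow> word_null T N [i, i]"
  using nc_cong_square[of i N]
  by (simp add: word_null_def free_gen_eq_u_word flip: u_word_append)

lemma word_null_equiv: "word_equiv T N a b \<Longrightarrow> word_null T N b \<Longrightarrow> word_null T N a"
  unfolding word_equiv_def word_null_def using nc_cong_trans by blast

text \<open>Let the last run end in \<open>s\<close>. A new letter \<open>j\<close> prolongs the run if \<open>j = s - 1\<close> and annihilates the word if \<open>j = s\<close>. Otherwise it
  can be moved to the left of the run: unchanged if \<open>j < s - 1\<close>, where it commutes with all letters of the run, and as \<open>j - 1\<close> after
  one braid move if \<open>j > s\<close>. There the shorter normal word absorbs it by induction.\<close>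

lemma normal_words_snoc:
  assumes "a \<in> normal_words N" "j \<in> {1..<N}" "N \<le> M"
  shows "word_null T M (a @ [j]) \<or> (\<exists>b \<in> normal_words N. word_equiv T M (a @ [j]) b)"
  using assms
proof (induction N arbitrary: a j)
  case (Suc N)
  from Suc.prems obtain a' s where a: "a = a' @ rev [s..<Suc N]" and a': "a' \<in> normal_words N" and s: "s \<in> {1..Suc N}"
    by auto
  have letters: "set a' \<subseteq> {1..<M}" "set (rev [s..<Suc N]) \<subseteq> {1..<M}"
    using normal_words_letters[OF a'] s Suc.prems by auto
  \<comment> \<open>Once a letter \<open>i < N\<close> has moved to the left of the last run, the induction hypothesis absorbs it.\<close>
  have absorb: ?case if i: "i \<in> {1..<N}" and eq: "word_equiv T M (rev [s..<Suc N] @ [j]) ([i] @ rev [s..<Suc N])" for i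
  proof -
    have e: "word_equiv T M (a @ [j]) ((a' @ [i]) @ rev [s..<Suc N])"
      using word_equiv_append[OF word_equiv_refl[OF letters(1)] eq] by (simp add: a)
    from Suc.IH[OF a' i] Suc.prems(3)
    consider "word_null T M (a' @ [i])" | b where "b \<in> normal_words N" "word_equiv T M (a' @ [i]) b"
      by auto
    then show ?thesis
    proof cases
      case 1
      then have "word_null T M ((a' @ [i]) @ rev [s..<Suc N])"
        using word_null_append[of T M "a' @ [i]" "[]" "rev [s..<Suc N]"] letters by simp
      with e show ?thesis
        using word_null_equiv by blast
    next
      case 2
      have "word_equiv T M (a @ [j]) (b @ rev [s..<Suc N])"
        using word_equiv_trans[OF e word_equiv_append[OF 2(2) word_equiv_refl[OF letters(2)]]] .
      with 2(1) s show ?thesis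
        unfolding normal_words.simps by blast
    qed
  qed
  consider "s = j + 1" | "s = j" | "j + 1 < s" | "s < j"
    by linarith
  then show ?case
  proof cases
    case 1
    then have "rev [s..<Suc N] @ [j] = rev [j..<Suc N]"
      using Suc.prems by (simp add: upt_conv_Cons)
    then have "a @ [j] \<in> normal_words (Suc N)"
      using normal_words_SucI[OF a', of j] a Suc.prems(2) by (simp del: upt_Suc normal_words.simps)
    moreover have "word_equiv T M (a @ [j]) (a @ [j])"
      using letters Suc.prems by (intro word_equiv_refl) (auto simp: a)
    ultimately show ?thesis by blast
  next
    case 2
    then have "rev [s..<Suc N] @ [j] = rev [Suc j..<Suc N] @ [j, j]"
      using Suc.prems by (simp add: upt_conv_Cons del: upt_Suc)
    moreover have "word_null T M ((a' @ rev [Suc j..<Suc N]) @ [j, j] @ [])"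
      using letters Suc.prems by (intro word_null_append word_null_square) auto
    ultimately show ?thesis by (simp add: a)
  next
    case 3
    show ?thesis
    proof (rule absorb)
      show "j \<in> {1..<N}" using 3 s Suc.prems by auto
      have "word_equiv T M (rev [s..<Suc N] @ [j]) (j # rev [s..<Suc N])"
        using 3 letters(2) Suc.prems by (intro word_equiv_commute_past) auto
      then show "word_equiv T M (rev [s..<Suc N] @ [j]) ([j] @ rev [s..<Suc N])"
        by simp
    qed
  next
    case 4
    define i where "i = j - 1"
    have j: "j = i + 1" and i: "s \<le> i" "i \<in> {1..<N}"
      using 4 s Suc.prems by (auto simp: i_def)
    have "[s..<Suc N] = [s..<i] @ [i, i + 1] @ [i + 2..<Suc N]"
      using i upt_add_eq_append[of s i "Suc N - i"] by (simp add: upt_conv_Cons del: upt_Suc)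
    then have run: "rev [s..<Suc N] = rev [i + 2..<Suc N] @ [i + 1, i] @ rev [s..<i]"
      by simp
    have sets: "set (rev [i + 2..<Suc N]) \<subseteq> {1..<M}" "set (rev [s..<i]) \<subseteq> {1..<M}" "i \<in> {1..<M}" "i + 1 \<in> {1..<M}"
      using i s Suc.prems(3) by auto
    have "word_equiv T M (rev [i + 2..<Suc N] @ [i + 1, i] @ (rev [s..<i] @ [j]))
                         (rev [i + 2..<Suc N] @ [i + 1, i] @ (j # rev [s..<i]))"
      using sets by (intro word_equiv_append word_equiv_refl word_equiv_commute_past) (auto simp: j)
    also have "rev [i + 2..<Suc N] @ [i + 1, i] @ (j # rev [s..<i]) = rev [i + 2..<Suc N] @ [i + 1, i, i + 1] @ rev [s..<i]"
      by (simp add: j)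
    also have "word_equiv T M \<dots> (rev [i + 2..<Suc N] @ [i, i + 1, i] @ rev [s..<i])"
      using sets by (intro word_equiv_append word_equiv_refl word_equiv_braid) auto
    also have "rev [i + 2..<Suc N] @ [i, i + 1, i] @ rev [s..<i]
             = (rev [i + 2..<Suc N] @ [i]) @ [i + 1, i] @ rev [s..<i]"
      by simp
    also have "word_equiv T M \<dots> ((i # rev [i + 2..<Suc N]) @ [i + 1, i] @ rev [s..<i])"
      using sets by (intro word_equiv_append[OF word_equiv_commute_past] word_equiv_refl) auto
    also have "\<dots> = [i] @ rev [s..<Suc N]"
      by (simp add: run del: upt_Suc)
    finally have "word_equiv T M (rev [s..<Suc N] @ [j]) ([i] @ rev [s..<Suc N])"
      by (simp add: run del: upt_Suc)
    with i(2) show ?thesis by (rule absorb)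
  qed
qed simp

lemma Nil_normal_word: "[] \<in> normal_words N"
proof (induction N)
  case (Suc N)
  then show ?case
    by (auto intro!: exI[of _ "[]"] exI[of _ "Suc N"])
qed simp

lemma word_null_or_normal:
  assumes "set a \<subseteq> {1..<N}"
  shows "word_null T N a \<or> (\<exists>b \<in> normal_words N. word_equiv T N a b)"
  using assms
proof (induction a rule: rev_induct)
  case Nil
  then show ?case
    using Nil_normal_word word_equiv_refl[of "[]" N T] by auto
next
  case (snoc j a)
  then have j: "j \<in> {1..<N}" and a: "set a \<subseteq> {1..<N}" by auto
  from snoc.IH[OF a] show ?case
  proof
    assume "word_null T N a"
    then have "word_null T N ([] @ a @ [j])"
      using j by (intro word_null_append) auto
    then show ?thesis by simp
  next
    assume "\<exists>b \<in> normal_words N. word_equiv T N a b"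
    then obtain b where b: "b \<in> normal_words N" "word_equiv T N a b" by blast
    have ab: "word_equiv T N (a @ [j]) (b @ [j])"
      using b j by (intro word_equiv_append word_equiv_refl) auto
    from normal_words_snoc[OF b(1) j order_refl, of T] show ?thesis
      using word_equiv_trans[OF ab] word_null_equiv[OF ab] by blast
  qed
qed

text \<open>The sum of coefficients over all reduced words of \<open>w\<close> is well defined on classes and takes the value 1 at \<open>a\<close>.\<close>

lemma word_null_not_reduced:
  assumes "reduced_word N a w"
  shows "\<not> word_null T N a"
proof
  assume "word_null T N a"
  then have "word_sum (perm_words {1..<N} (length a) w) (u_word a) = (0 :: 'a)"
    using word_sum_cong[OF reduced_word_perm_words(1)[OF assms], of N "u_word a" "0 :: word \<Rightarrow>\<^sub>0 'a"]
    by (simp add: word_null_def)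
  moreover have "a \<in> perm_words {1..<N} (length a) w"
    using assms reduced_word_perm_words(2) by blast
  ultimately show False
    by (simp add: word_sum_u_word)
qed

text \<open>Matsumoto's theorem, in the form needed here: both words are equivalent to normal words, and normal words with the same permutation
  are equal.\<close>

lemma reduced_words_equiv:
  assumes "reduced_word N a w" "reduced_word N b w"
  shows "word_equiv T N a b"
proof -
  have "\<exists>c \<in> normal_words N. word_equiv T N a c" if "reduced_word N a w" for a
    using word_null_or_normal[of a N T] word_null_not_reduced[OF that, of T] that
    by (auto simp: reduced_word_def)
  then obtain c d where c: "c \<in> normal_words N" "word_equiv T N a c"
    and d: "d \<in> normal_words N" "word_equiv T N b d"
    using assms by blast
  moreover have "c = d"
    using c d assms by (intro normal_words_inj) (auto simp: word_equiv_def reduced_word_def)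
  ultimately show ?thesis
    unfolding word_equiv_def using nc_cong_sym nc_cong_trans by metis
qed

lemma reduced_word_exists:
  assumes "v permutes {1..N}"
  shows "\<exists>a. reduced_word N a v"
proof -
  let ?P = "\<lambda>a. set a \<subseteq> {1..<N} \<and> word_perm a = v"
  obtain a where "?P a"
    using normal_words_surj[OF assms] normal_words_letters by blast
  then have "?P (arg_min length ?P)" "\<forall>b. ?P b \<longrightarrow> length (arg_min length ?P) \<le> length b"
    using arg_min_nat_lemma[of ?P a length] by auto
  then show ?thesis
    unfolding reduced_word_def by blast
qed

lemma free_alg_carrier_induct [consumes 1, case_names zero add word]:
  assumes f: "f \<in> carrier (free_alg N)"
    and "P 0" and "\<And>f g. P f \<Longrightarrow> P g \<Longrightarrow> P (f + g)"
    and "\<And>c a. set a \<subseteq> {1..<N} \<Longrightarrow> P (free_scalar c * u_word a)"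
  shows "P f"
proof -
  have "P (\<Sum>w\<in>A. free_scalar (Poly_Mapping.lookup f w) * u_word (letters w))"
    if "A \<subseteq> Poly_Mapping.keys f" for A
    using finite_subset[OF that finite_keys] that f
    by (induction A rule: finite_induct) (auto simp: free_alg_carrier assms)
  from this[OF order_refl] show ?thesis
    by (simp only: free_alg_expand[symmetric])
qed

definition chosen_word :: "nat \<Rightarrow> (nat \<Rightarrow> nat) \<Rightarrow> nat list" where
  "chosen_word N v = (SOME a. reduced_word N a v)"

lemma chosen_word_reduced: "v permutes {1..N} \<Longrightarrow> reduced_word N (chosen_word N v) v"
  unfolding chosen_word_def by (rule someI_ex[OF reduced_word_exists])

lemma chosen_word_letters: "v permutes {1..N} \<Longrightarrow> set (chosen_word N v) \<subseteq> {1..<N}"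
  using chosen_word_reduced by (auto simp: reduced_word_def)

lemma prod_list_free_gen: "prod_list (map free_gen a) = u_word a"
  by (induction a) (simp_all add: u_word_Nil free_gen_eq_u_word flip: u_word_append)

lemma nc_basis_class:
  assumes "v permutes {1..N}"
  shows "nc_basis N v = nc_class N (u_word (chosen_word N v))"
proof -
  have "set (map free_gen (chosen_word N v)) \<subseteq> carrier (free_alg N)"
    using chosen_word_letters[OF assms] by (force intro!: free_alg_gen)
  from nc_prod_class[OF this] show ?thesis
    by (simp add: nc_basis_def chosen_word_def[symmetric] nc_gen_def[abs_def] comp_def prod_list_free_gen)
qed

lemma nc_smult_class:
  "f \<in> carrier (free_alg N) \<Longrightarrow> nc_smult N c (nc_class N f) = nc_class N (free_scalar c * f)"
  by (simp add: nc_smult_def nc_scalar_def nc_class_mult free_alg_scalar)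

text \<open>A representative of the linear combination of the basis elements with coefficients \<open>c\<close>.\<close>

definition perm_comb :: "nat \<Rightarrow> ((nat \<Rightarrow> nat) \<Rightarrow> 'a::comm_ring_1) \<Rightarrow> (word \<Rightarrow>\<^sub>0 'a)" where
  "perm_comb N c = (\<Sum>v | v permutes {1..N}. free_scalar (c v) * u_word (chosen_word N v))"

lemma perm_comb_carrier: "perm_comb N c \<in> carrier (free_alg N)"
  unfolding perm_comb_def
  by (auto intro!: free_alg_sum free_alg_mult free_alg_scalar free_alg_word chosen_word_letters[THEN subsetD])

lemma nc_class_perm_comb:
  "(\<Oplus>\<^bsub>nilcoxeter N\<^esub>v\<in>{v. v permutes {1..N}}. nc_smult N (c v) (nc_basis N v)) = nc_class N (perm_comb N c)"
proof -
  have car: "free_scalar (c v) * u_word (chosen_word N v) \<in> carrier (free_alg N)" if "v permutes {1..N}" for v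
    using chosen_word_letters[OF that] by (intro free_alg_mult free_alg_scalar free_alg_word)
  interpret ring "nilcoxeter N :: (word \<Rightarrow>\<^sub>0 'a) set ring" by (rule ring_nilcoxeter)
  have "(\<Oplus>\<^bsub>nilcoxeter N\<^esub>v\<in>{v. v permutes {1..N}}. nc_smult N (c v) (nc_basis N v))
      = (\<Oplus>\<^bsub>nilcoxeter N\<^esub>v\<in>{v. v permutes {1..N}}. nc_class N (free_scalar (c v) * u_word (chosen_word N v)))"
  proof (rule finsum_cong')
    show "(\<lambda>v. nc_class N (free_scalar (c v) * u_word (chosen_word N v))) \<in> {v. v permutes {1..N}} \<rightarrow> carrier (nilcoxeter N)"
      using car by (auto intro: nc_class_carrier)
    fix v assume "v \<in> {v. v permutes {1..N}}"
    then show "nc_smult N (c v) (nc_basis N v) = nc_class N (free_scalar (c v) * u_word (chosen_word N v))"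
      using chosen_word_letters[of v N] by (simp add: nc_basis_class nc_smult_class free_alg_word)
  qed simp
  also have "\<dots> = nc_class N (perm_comb N c)"
    unfolding perm_comb_def using car by (intro nc_finsum_class finite_permutations) auto
  finally show ?thesis .
qed

abbreviation reduced_words :: "nat \<Rightarrow> (nat \<Rightarrow> nat) \<Rightarrow> nat list set" where
  "reduced_words N v \<equiv> {a. reduced_word N a v}"

lemma nil_closed_reduced_words:
  assumes "v permutes {1..N}"
  shows "nil_closed (reduced_words N v)"
proof -
  note r = chosen_word_reduced[OF assms]
  have "reduced_words N v = perm_words {1..<N} (length (chosen_word N v)) v"
    using reduced_word_perm_words(2)[OF r] by blast
  with reduced_word_perm_words(1)[OF r] show ?thesis by simp
qed

lemma chosen_word_in_reduced_words:
  "v permutes {1..N} \<Longrightarrow> chosen_word N v \<in> reduced_words N v' \<longleftrightarrow> v = v'"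
  using chosen_word_reduced[of v N] by (auto simp: reduced_word_def)

text \<open>Linear independence: summing over the reduced words of \<open>v\<close> extracts the coefficient of \<open>v\<close>.\<close>

lemma word_sum_perm_comb:
  assumes "v permutes {1..N}"
  shows "word_sum (reduced_words N v) (perm_comb N c) = c v"
proof -
  have "word_sum (reduced_words N v) (perm_comb N c)
      = (\<Sum>v' | v' permutes {1..N}. if v' = v then c v' else 0)"
    unfolding perm_comb_def word_sum_sum
  proof (intro sum.cong refl)
    fix v' assume "v' \<in> {v'. v' permutes {1..N}}"
    then show "word_sum (reduced_words N v) (free_scalar (c v') * u_word (chosen_word N v')) = (if v' = v then c v' else 0)"
      using chosen_word_in_reduced_words[of v' N v] by (simp add: word_sum_scalar word_sum_u_word)
  qed
  then show ?thesis
    using assms by (simp add: sum.delta finite_permutations)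
qed

text \<open>Spanning: a word is either null, and then its sum over any set of reduced words vanishes too, or it is equivalent to the chosen
  reduced word of its permutation.\<close>

lemma nc_class_basis_expansion:
  fixes f :: "word \<Rightarrow>\<^sub>0 'a::comm_ring_1"
  assumes "f \<in> carrier (free_alg N)"
  shows "nc_cong N f (perm_comb N (\<lambda>v. word_sum (reduced_words N v) f))"
  using assms
proof (induction f rule: free_alg_carrier_induct)
  case zero
  then show ?case
    by (simp add: perm_comb_def nc_cong_refl free_alg_0)
next
  case (add f g)
  have "perm_comb N (\<lambda>v. word_sum (reduced_words N v) (f + g))
      = perm_comb N (\<lambda>v. word_sum (reduced_words N v) f) + perm_comb N (\<lambda>v. word_sum (reduced_words N v) g)"
    by (simp add: perm_comb_def word_sum_add free_scalar_add distrib_right sum.distrib)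
  with add show ?case
    by (simp add: nc_cong_add)
next
  case (word c a)
  have "perm_comb N (\<lambda>v. word_sum (reduced_words N v) (free_scalar c * u_word a))
      = free_scalar c * perm_comb N (\<lambda>v. word_sum (reduced_words N v) (u_word a))"
    by (simp add: perm_comb_def word_sum_scalar free_scalar_mult sum_distrib_left mult.assoc)
  moreover have "nc_cong N (u_word a) (perm_comb N (\<lambda>v. word_sum (reduced_words N v) (u_word a :: word \<Rightarrow>\<^sub>0 'a)))"
    using word_null_or_normal[OF word, of "TYPE('a)"]
  proof (elim disjE bexE)
    assume null: "word_null TYPE('a) N a"
    then have "word_sum (reduced_words N v) (u_word a :: word \<Rightarrow>\<^sub>0 'a) = 0" if "v permutes {1..N}" for v
      using word_sum_cong[OF nil_closed_reduced_words[OF that], of N "u_word a" "0 :: word \<Rightarrow>\<^sub>0 'a"]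
      by (simp add: word_null_def)
    then have "perm_comb N (\<lambda>v. word_sum (reduced_words N v) (u_word a :: word \<Rightarrow>\<^sub>0 'a)) = 0"
      by (simp add: perm_comb_def)
    with null show ?thesis
      by (simp add: word_null_def)
  next
    fix b assume b: "b \<in> normal_words N" "word_equiv TYPE('a) N a b"
    define w where "w = word_perm a"
    have w: "w permutes {1..N}"
      unfolding w_def using word by (rule word_perm_permutes)
    note r = chosen_word_reduced[OF w]
    obtain d where d: "d \<in> normal_words N" "word_equiv TYPE('a) N (chosen_word N w) d"
      using word_null_or_normal[OF chosen_word_letters[OF w]] word_null_not_reduced[OF r] by blast
    have "b = d"
      using b d r by (intro normal_words_inj) (auto simp: word_equiv_def w_def reduced_word_def)
    then have a: "nc_cong N (u_word a) (u_word (chosen_word N w) :: word \<Rightarrow>\<^sub>0 'a)"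
      using b d nc_cong_sym nc_cong_trans unfolding word_equiv_def by metis
    have "perm_comb N (\<lambda>v. word_sum (reduced_words N v) (u_word a :: word \<Rightarrow>\<^sub>0 'a))
       = (\<Sum>v | v permutes {1..N}. if v = w then u_word (chosen_word N v) else 0)"
      unfolding perm_comb_def
    proof (intro sum.cong refl)
      fix v assume "v \<in> {v. v permutes {1..N}}"
      then have "word_sum (reduced_words N v) (u_word a :: word \<Rightarrow>\<^sub>0 'a) = (if w = v then 1 else 0)"
        using word_sum_cong[OF nil_closed_reduced_words a, of v] chosen_word_in_reduced_words[OF w, of v]
        by (simp add: word_sum_u_word)
      then show "free_scalar (word_sum (reduced_words N v) (u_word a :: word \<Rightarrow>\<^sub>0 'a)) * u_word (chosen_word N v)
          = (if v = w then u_word (chosen_word N v) else 0)"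
        by auto
    qed
    also have "\<dots> = u_word (chosen_word N w)"
      using w by (simp add: sum.delta finite_permutations)
    finally show ?thesis
      using a by simp
  qed
  ultimately show ?case
    by (simp add: nc_cong_mult nc_cong_refl free_alg_scalar)
qed

lemma nc_coeff_class:
  fixes f :: "word \<Rightarrow>\<^sub>0 'a::comm_ring_1"
  assumes f: "f \<in> carrier (free_alg N)" and w: "w permutes {1..N}"
  shows "nc_coeff N (nc_class N f) w = word_sum (reduced_words N w) f"
proof -
  let ?c = "\<lambda>v. if v permutes {1..N} then word_sum (reduced_words N v) f else 0"
  have "nc_coeff N (nc_class N f) = ?c"
    unfolding nc_coeff_def nc_class_perm_comb nc_class_eq_iff[OF f perm_comb_carrier]
  proof (rule the_equality)
    have "perm_comb N ?c = perm_comb N (\<lambda>v. word_sum (reduced_words N v) f)"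
      by (simp add: perm_comb_def)
    then show "(\<forall>v. \<not> v permutes {1..N} \<longrightarrow> ?c v = 0) \<and> nc_cong N f (perm_comb N ?c)"
      using nc_class_basis_expansion[OF f] by simp
  next
    fix c :: "(nat \<Rightarrow> nat) \<Rightarrow> 'a"
    assume c: "(\<forall>v. \<not> v permutes {1..N} \<longrightarrow> c v = 0) \<and> nc_cong N f (perm_comb N c)"
    show "c = ?c"
    proof
      fix v
      show "c v = ?c v"
      proof (cases "v permutes {1..N}")
        case True
        then have "word_sum (reduced_words N v) f = c v"
          using word_sum_cong[OF nil_closed_reduced_words[OF True]] c word_sum_perm_comb[OF True] by metis
        with True show ?thesis by simp
      qed (use c in simp)
    qed
  qed
  with w show ?thesis by simp
qed

text \<open>The set \<open>S\<close> need not consist of all reduced words of \<open>w\<close>. By Matsumoto's theorem the functional of any such \<open>S\<close> takes the value 1 at the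
  basis element of \<open>w\<close> and 0 at the others. For \<open>w = 1\<^sub>m \<times> \<varpi>\<^sub>0\<close> it will be convenient to admit only words without the letters
  \<open>1, \<dots>, m\<close>.\<close>

lemma nc_coeff_eq_word_sum:
  fixes f :: "word \<Rightarrow>\<^sub>0 'a::comm_ring_1"
  assumes f: "f \<in> carrier (free_alg N)"
    and S: "nil_closed S" "\<And>a. a \<in> S \<Longrightarrow> word_perm a = w"
    and e: "e \<in> S" "reduced_word N e w"
  shows "nc_coeff N (nc_class N f) w = word_sum S f"
proof -
  have w: "w permutes {1..N}"
    using e word_perm_permutes by (auto simp: reduced_word_def)
  let ?c = "\<lambda>v. word_sum (reduced_words N v) f"
  have chosen: "word_sum S (u_word (chosen_word N v) :: word \<Rightarrow>\<^sub>0 'a) = (if v = w then 1 else 0)"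
    if v: "v permutes {1..N}" for v
  proof (cases "v = w")
    case True
    have "nc_cong N (u_word (chosen_word N w)) (u_word e :: word \<Rightarrow>\<^sub>0 'a)"
      using reduced_words_equiv[OF chosen_word_reduced[OF w] e(2)] by (auto simp: word_equiv_def)
    from word_sum_cong[OF S(1) this] True e show ?thesis
      by (simp add: word_sum_u_word)
  next
    case False
    have "chosen_word N v \<notin> S"
      using S(2) False chosen_word_reduced[OF v] unfolding reduced_word_def by metis
    with False show ?thesis by (simp add: word_sum_u_word)
  qed
  have "word_sum S f = word_sum S (perm_comb N ?c)"
    by (rule word_sum_cong[OF S(1) nc_class_basis_expansion[OF f]])
  also have "\<dots> = (\<Sum>v | v permutes {1..N}. if v = w then ?c v else 0)"
    unfolding perm_comb_def word_sum_sum by (intro sum.cong refl) (simp add: word_sum_scalar chosen)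
  also have "\<dots> = ?c w"
    using w by (simp add: sum.delta finite_permutations)
  finally show ?thesis
    using nc_coeff_class[OF f w] by simp
qed

section \<open>Inversions and the word of the longest permutation\<close>

definition inversions :: "(nat \<Rightarrow> nat) \<Rightarrow> (nat \<times> nat) set" where
  "inversions w = {(p, q). p < q \<and> w q < w p}"

text \<open>Composing with a transposition of the values \<open>i, i + 1\<close> can only create the inversion at the two positions where these values are
  taken. This bounds the length of a word from below.\<close>

lemma inversions_word_perm: "finite (inversions (word_perm a)) \<and> card (inversions (word_perm a)) \<le> length a"
proof (induction a)
  case Nil
  have "inversions (word_perm []) = {}"
    by (auto simp: inversions_def)
  then show ?case
    unfolding \<open>inversions (word_perm []) = {}\<close> by simp
next
  case (Cons i a)
  let ?w = "word_perm a"
  have "inversions (word_perm (i # a)) \<subseteq> insert (inv_into UNIV ?w i, inv_into UNIV ?w (i + 1)) (inversions ?w)"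
  proof
    fix pq assume pq: "pq \<in> inversions (word_perm (i # a))"
    obtain p q where [simp]: "pq = (p, q)" by (cases pq)
    have inj: "inj ?w" using bij_word_perm by (rule bij_is_inj)
    from pq have lt: "p < q" "Transposition.transpose i (i + 1) (?w q) < Transposition.transpose i (i + 1) (?w p)"
      by (auto simp: inversions_def word_perm_Cons)
    have "?w q \<noteq> ?w p"
      using inj lt(1) by (auto dest: injD)
    show "pq \<in> insert (inv_into UNIV ?w i, inv_into UNIV ?w (i + 1)) (inversions ?w)"
    proof (cases "?w q < ?w p")
      case False
      with lt \<open>?w q \<noteq> ?w p\<close> have "?w p = i" "?w q = i + 1"
        by (auto simp: Transposition.transpose_def split: if_splits)
      then show ?thesis
        using inv_f_f[OF inj, of p] inv_f_f[OF inj, of q] by simp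
    qed (use lt in \<open>simp add: inversions_def\<close>)
  qed
  with Cons.IH show ?case
    by (auto dest: finite_subset card_mono[rotated] simp: card_insert_if split: if_splits)
qed

text \<open>The word \<open>(N-1)(N-2, N-1) \<dots> (s, \<dots>, N-1)\<close>, a reduced word of the permutation that reverses \<open>{s..N}\<close>.\<close>

definition stair_word :: "nat \<Rightarrow> nat \<Rightarrow> nat list" where
  "stair_word s N = concat (map (\<lambda>k. [k..<N]) (rev [s..<N]))"

lemma word_perm_ascending_run:
  assumes "s \<le> N"
  shows "word_perm [s..<N] x = (if x = N then s else if s \<le> x \<and> x < N then x + 1 else x)"
  using assms
proof (induction s arbitrary: x rule: inc_induct)
  case (step s)
  then have "[s..<N] = s # [Suc s..<N]"
    by (simp add: upt_conv_Cons)
  with step show ?case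
    by (auto simp: word_perm_Cons Transposition.transpose_def)
qed auto

lemma word_perm_stair_word:
  assumes "s \<le> N"
  shows "word_perm (stair_word s N) x = (if s \<le> x \<and> x \<le> N then s + N - x else x)"
  using assms
proof (induction s arbitrary: x rule: inc_induct)
  case (step s)
  then have "stair_word s N = stair_word (Suc s) N @ [s..<N]"
    by (simp add: stair_word_def upt_conv_Cons)
  with step show ?case
    by (auto simp: word_perm_append word_perm_ascending_run simp del: upt_Suc)
qed (auto simp: stair_word_def)

lemma length_stair_word: "length (stair_word s N) = (\<Sum>k = s..<N. N - k)"
  by (simp add: stair_word_def length_concat comp_def interv_sum_list_conv_sum_set_nat flip: rev_map)

lemma set_stair_word: "set (stair_word s N) \<subseteq> {s..<N}"
  by (auto simp: stair_word_def)

lemma stair_word_minimal: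
  assumes "s \<le> N" "word_perm b = word_perm (stair_word s N)"
  shows "length (stair_word s N) \<le> length b"
proof -
  have "Sigma {s..<N} (\<lambda>p. {p<..N}) \<subseteq> inversions (word_perm b)"
    using assms by (auto simp: inversions_def word_perm_stair_word)
  then have "card (Sigma {s..<N} (\<lambda>p. {p<..N})) \<le> card (inversions (word_perm b))"
    using inversions_word_perm by (intro card_mono) auto
  also have "\<dots> \<le> length b"
    using inversions_word_perm by blast
  finally show ?thesis
    by (simp add: length_stair_word)
qed

section \<open>The linear factors and the Yang--Baxter equation\<close>

definition lin_factor :: "nat \<Rightarrow> 'a::comm_ring_1 \<Rightarrow> (word \<Rightarrow>\<^sub>0 'a)" where
  "lin_factor j x = 1 + free_scalar x * free_gen j"

definition ascending_prod :: "nat \<Rightarrow> nat \<Rightarrow> 'a::comm_ring_1 \<Rightarrow> (word \<Rightarrow>\<^sub>0 'a)" where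
  "ascending_prod N k x = prod_list (map (\<lambda>j. lin_factor j x) [k..<N])"

definition descending_prod :: "nat \<Rightarrow> nat \<Rightarrow> 'a::comm_ring_1 \<Rightarrow> (word \<Rightarrow>\<^sub>0 'a)" where
  "descending_prod N k x = prod_list (map (\<lambda>j. lin_factor j x) (rev [k..<N]))"

lemma lin_factor_carrier: "1 \<le> j \<Longrightarrow> j < N \<Longrightarrow> lin_factor j x \<in> carrier (free_alg N)"
  unfolding lin_factor_def by (intro free_alg_add free_alg_mult free_alg_1 free_alg_scalar free_alg_gen)

lemma ascending_prod_carrier: "1 \<le> k \<Longrightarrow> ascending_prod N k x \<in> carrier (free_alg N)"
  and descending_prod_carrier: "1 \<le> k \<Longrightarrow> descending_prod N k x \<in> carrier (free_alg N)"
  unfolding ascending_prod_def descending_prod_def by (auto intro!: free_alg_prod_list lin_factor_carrier)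

lemma ascending_prod_rec: "k < N \<Longrightarrow> ascending_prod N k x = lin_factor k x * ascending_prod N (Suc k) x"
  and descending_prod_rec: "k < N \<Longrightarrow> descending_prod N k x = descending_prod N (Suc k) x * lin_factor k x"
  by (simp_all add: ascending_prod_def descending_prod_def upt_conv_Cons)

lemma ascending_prod_end [simp]: "N \<le> k \<Longrightarrow> ascending_prod N k x = 1"
  and descending_prod_end [simp]: "N \<le> k \<Longrightarrow> descending_prod N k x = 1"
  by (simp_all add: ascending_prod_def descending_prod_def)

lemma lin_factor_0: "lin_factor j 0 = 1"
  by (simp add: lin_factor_def)

lemmas gen_scalar = free_scalar_comm[of "free_gen i" for i] free_scalar_left_comm[of "free_gen i" for i]

lemma scalar_scalar: "free_scalar c * (free_scalar d * f) = free_scalar (c * d) * f"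
  by (simp add: free_scalar_mult mult.assoc)

lemma nc_cong_scalar_gen:
  assumes "nc_cong N f g" "h \<in> carrier (free_alg N)"
  shows "nc_cong N (h + free_scalar c * f) (h + free_scalar c * g)"
  by (intro nc_cong_add nc_cong_mult nc_cong_refl free_alg_scalar assms)

lemma lin_factor_add:
  assumes "k \<in> {1..<N}"
  shows "nc_cong N (lin_factor k x * lin_factor k y) (lin_factor k (x + y))"
proof -
  have "lin_factor k x * lin_factor k y = lin_factor k (x + y) + free_scalar (x * y) * (free_gen k * free_gen k)"
    by (simp add: lin_factor_def distrib_left distrib_right gen_scalar scalar_scalar free_scalar_add mult.assoc)
  moreover have "nc_cong N \<dots> (lin_factor k (x + y) + free_scalar (x * y) * 0)"
    using assms by (intro nc_cong_scalar_gen nc_cong_square lin_factor_carrier) auto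
  ultimately show ?thesis by simp
qed

lemma lin_factor_commute:
  assumes "i \<in> {1..<N}" "j \<in> {1..<N}" "\<bar>int i - int j\<bar> \<ge> 2"
  shows "nc_cong N (lin_factor i x * lin_factor j y) (lin_factor j y * lin_factor i x)"
proof -
  let ?h = "1 + free_scalar x * free_gen i + free_scalar y * free_gen j"
  have "lin_factor i x * lin_factor j y = ?h + free_scalar (x * y) * (free_gen i * free_gen j)"
    by (simp add: lin_factor_def distrib_left distrib_right gen_scalar scalar_scalar mult.assoc)
  moreover have "lin_factor j y * lin_factor i x = ?h + free_scalar (x * y) * (free_gen j * free_gen i)"
    by (simp add: lin_factor_def distrib_left distrib_right gen_scalar scalar_scalar mult.assoc mult.commute[of x y])
  moreover have "?h \<in> carrier (free_alg N)"
    using assms by (intro free_alg_add free_alg_mult free_alg_1 free_alg_scalar free_alg_gen) auto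
  ultimately show ?thesis
    using nc_cong_scalar_gen[OF nc_cong_commute[OF assms]] by simp
qed

text \<open>Expanding both sides gives the same combination of \<open>1, u, v, uv, vu\<close>, where \<open>u = u\<^sub>i\<close> and \<open>v = u\<^bsub>i+1\<^esub>\<close>. What is left are multiples of \<open>uu\<close> and
  \<open>vv\<close>, which vanish, and the same multiple of \<open>uvu\<close> and of \<open>vuv\<close>.\<close>

lemma yang_baxter:
  fixes a b :: "'a::comm_ring_1"
  assumes "i \<in> {1..<N}" "i + 1 \<in> {1..<N}"
  shows "nc_cong N (lin_factor i (b - a) * (lin_factor (i + 1) b * lin_factor i a)) (lin_factor (i + 1) a * (lin_factor i b * lin_factor (i + 1) (b - a)))"
proof -
  define u :: "word \<Rightarrow>\<^sub>0 'a" where "u = free_gen i"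
  define v :: "word \<Rightarrow>\<^sub>0 'a" where "v = free_gen (Suc i)"
  have uv: "u \<in> carrier (free_alg N)" "v \<in> carrier (free_alg N)"
    using assms by (auto simp: u_def v_def intro!: free_alg_gen)
  let ?h = "1 + free_scalar b * u + free_scalar b * v + free_scalar ((b - a) * b) * (u * v)
      + free_scalar (a * b) * (v * u)"
  let ?c = "(b - a) * b * a"
  have h: "?h \<in> carrier (free_alg N)"
    using uv by (intro free_alg_add free_alg_mult free_alg_1 free_alg_scalar)
  note comm = free_scalar_comm[of u] free_scalar_comm[of v] free_scalar_left_comm[of u] free_scalar_left_comm[of v]
  have L: "lin_factor i (b - a) * (lin_factor (i + 1) b * lin_factor i a) =
      ?h + free_scalar ((b - a) * a) * (u * u) + free_scalar ?c * (u * v * u)"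
    by (simp add: lin_factor_def u_def[symmetric] v_def[symmetric] distrib_left distrib_right comm scalar_scalar mult.assoc)
       (simp add: algebra_simps free_scalar_diff)
  have R: "lin_factor (i + 1) a * (lin_factor i b * lin_factor (i + 1) (b - a)) =
      ?h + free_scalar (a * (b - a)) * (v * v) + free_scalar ?c * (v * u * v)"
    by (simp add: lin_factor_def u_def[symmetric] v_def[symmetric] distrib_left distrib_right comm scalar_scalar mult.assoc)
       (simp add: algebra_simps free_scalar_diff)
  have u2: "nc_cong N (u * u) 0" and v2: "nc_cong N (v * v) 0" and uvu: "nc_cong N (u * v * u) (v * u * v)"
    using assms nc_cong_square[of i N] nc_cong_square[of "i + 1" N] nc_cong_braid[OF assms]
    by (simp_all add: u_def v_def)
  have c1: "nc_cong N (?h + free_scalar ((b - a) * a) * (u * u) + free_scalar ?c * (u * v * u))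
                  (?h + free_scalar ((b - a) * a) * 0 + free_scalar ?c * (v * u * v))"
    using u2 uvu h by (intro nc_cong_add nc_cong_mult[OF nc_cong_refl] nc_cong_refl[of ?h] free_alg_scalar)
  have c2: "nc_cong N (?h + free_scalar (a * (b - a)) * (v * v) + free_scalar ?c * (v * u * v))
                  (?h + free_scalar (a * (b - a)) * 0 + free_scalar ?c * (v * u * v))"
    using v2 h uv
    by (intro nc_cong_add nc_cong_mult[OF nc_cong_refl] nc_cong_refl free_alg_scalar free_alg_mult)
  show ?thesis
    unfolding L R
    by (rule nc_cong_trans[OF c1[unfolded mult_zero_right add_0_right]
          nc_cong_sym[OF c2[unfolded mult_zero_right add_0_right]]])
qed

lemma lin_factor_commute_prod:
  assumes "i \<in> {1..<N}" "set js \<subseteq> {1..<N}" "\<forall>j \<in> set js. \<bar>int i - int j\<bar> \<ge> 2"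
  shows "nc_cong N (lin_factor i x * prod_list (map (\<lambda>j. lin_factor j (y j)) js)) (prod_list (map (\<lambda>j. lin_factor j (y j)) js) * lin_factor i x)"
  using assms(2,3)
proof (induction js)
  case Nil
  with assms(1) show ?case by (auto intro!: nc_cong_refl lin_factor_carrier)
next
  case (Cons j js)
  let ?p = "prod_list (map (\<lambda>j. lin_factor j (y j)) js)"
  have p: "?p \<in> carrier (free_alg N)"
    using Cons.prems by (intro free_alg_prod_list) (auto intro!: lin_factor_carrier)
  have "nc_cong N ((lin_factor i x * lin_factor j (y j)) * ?p) ((lin_factor j (y j) * lin_factor i x) * ?p)"
    using Cons.prems assms(1) p by (intro nc_cong_mult nc_cong_refl lin_factor_commute) auto
  also have "(lin_factor j (y j) * lin_factor i x) * ?p = lin_factor j (y j) * (lin_factor i x * ?p)"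
    by (simp add: mult.assoc)
  also have "nc_cong N \<dots> (lin_factor j (y j) * (?p * lin_factor i x))"
    using Cons by (intro nc_cong_mult[OF nc_cong_refl] lin_factor_carrier) auto
  finally show ?case
    by (simp add: mult.assoc)
qed

lemma lin_factor_commute_ascending:
  assumes "1 \<le> i" "i + 2 \<le> k" "i < N"
  shows "nc_cong N (lin_factor i x * ascending_prod N k y) (ascending_prod N k y * lin_factor i x)"
  unfolding ascending_prod_def using assms by (intro lin_factor_commute_prod) auto

text \<open>Downward induction on \<open>k\<close>. After splitting off the first factors, the Yang--Baxter equation moves the factor with parameter \<open>b - a\<close>
  from index \<open>k\<close> to index \<open>k + 1\<close>.\<close>

lemma ascending_prod_exchange:
  assumes "1 \<le> k" "k < N"
  shows "nc_cong N (lin_factor k (b - a) * (ascending_prod N (Suc k) b * ascending_prod N k a)) (ascending_prod N (Suc k) a * ascending_prod N k b)"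
proof -
  have "k \<le> N - 1" using assms by simp
  then show ?thesis using assms(1)
  proof (induction k rule: inc_induct)
    case base
    with assms have "ascending_prod N (N - 1) c = lin_factor (N - 1) c" for c :: 'a
      using ascending_prod_rec[of "N - 1" N c] by simp
    with base assms show ?case
      using lin_factor_add[of "N - 1" N "b - a" a] by simp
  next
    case (step k)
    then have k: "Suc k < N" "1 \<le> k" by auto
    let ?B = "ascending_prod N (Suc k)" and ?C = "ascending_prod N (Suc (Suc k))"
    note car = lin_factor_carrier[of k N] lin_factor_carrier[of "Suc k" N] ascending_prod_carrier[of "Suc k" N] ascending_prod_carrier[of "Suc (Suc k)" N]
    have B: "?B c = lin_factor (Suc k) c * ?C c" "ascending_prod N k c = lin_factor k c * ?B c" for c :: 'a
      using k by (auto intro!: ascending_prod_rec)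
    have "lin_factor k (b - a) * (?B b * ascending_prod N k a) = (lin_factor k (b - a) * lin_factor (Suc k) b) * ((?C b * lin_factor k a) * ?B a)"
      by (simp add: B(1)[of b] B(2)[of a] mult.assoc)
    also have "nc_cong N \<dots> ((lin_factor k (b - a) * lin_factor (Suc k) b) * ((lin_factor k a * ?C b) * ?B a))"
      using k by (intro nc_cong_mult nc_cong_refl free_alg_mult car nc_cong_sym[OF lin_factor_commute_ascending]) auto
    also have "(lin_factor k (b - a) * lin_factor (Suc k) b) * ((lin_factor k a * ?C b) * ?B a)
        = (lin_factor k (b - a) * (lin_factor (k + 1) b * lin_factor k a)) * (?C b * ?B a)"
      by (simp add: mult.assoc)
    also have "nc_cong N \<dots> ((lin_factor (k + 1) a * (lin_factor k b * lin_factor (k + 1) (b - a))) * (?C b * ?B a))"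
      using k by (intro nc_cong_mult nc_cong_refl free_alg_mult car yang_baxter) auto
    also have "(lin_factor (k + 1) a * (lin_factor k b * lin_factor (k + 1) (b - a))) * (?C b * ?B a)
        = (lin_factor (Suc k) a * lin_factor k b) * (lin_factor (Suc k) (b - a) * (?C b * ?B a))"
      by (simp add: mult.assoc)
    also have "nc_cong N \<dots> ((lin_factor (Suc k) a * lin_factor k b) * (?C a * ?B b))"
      using k step.IH by (intro nc_cong_mult[OF nc_cong_refl] free_alg_mult car) auto
    also have "(lin_factor (Suc k) a * lin_factor k b) * (?C a * ?B b) = lin_factor (Suc k) a * ((lin_factor k b * ?C a) * ?B b)"
      by (simp add: mult.assoc)
    also have "nc_cong N \<dots> (lin_factor (Suc k) a * ((?C a * lin_factor k b) * ?B b))"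
      using k by (intro nc_cong_mult nc_cong_refl free_alg_mult car lin_factor_commute_ascending) auto
    also have "lin_factor (Suc k) a * ((?C a * lin_factor k b) * ?B b) = ?B a * ascending_prod N k b"
      by (simp add: B(1)[of a] B(2)[of b] mult.assoc)
    finally show ?case .
  qed
qed

lemma descending_ascending_inverse:
  assumes "1 \<le> k"
  shows "nc_cong N (descending_prod N k x * ascending_prod N k (- x)) 1" "nc_cong N (ascending_prod N k (- x) * descending_prod N k x) 1"
proof -
  have "nc_cong N (descending_prod N k x * ascending_prod N k (- x)) 1 \<and> nc_cong N (ascending_prod N k (- x) * descending_prod N k x) 1"
  proof (cases "k \<le> N")
    case True
    then show ?thesis using assms
    proof (induction k rule: inc_induct)
      case base
      then show ?case by (simp add: nc_cong_refl free_alg_1)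
    next
      case (step k)
      note car = lin_factor_carrier[of k N] ascending_prod_carrier[of "Suc k" N] descending_prod_carrier[of "Suc k" N]
      have inv: "nc_cong N (lin_factor k c * lin_factor k (- c)) 1" for c :: 'a
        using lin_factor_add[of k N c "- c"] step by (simp add: lin_factor_0)
      have "descending_prod N k x * ascending_prod N k (- x) = descending_prod N (Suc k) x * ((lin_factor k x * lin_factor k (- x)) * ascending_prod N (Suc k) (- x))"
        using step by (simp add: ascending_prod_rec descending_prod_rec mult.assoc)
      also have "nc_cong N \<dots> (descending_prod N (Suc k) x * (1 * ascending_prod N (Suc k) (- x)))"
        using step by (intro nc_cong_mult nc_cong_refl car inv) auto
      also have "nc_cong N \<dots> 1"
        using step by simp
      finally have 1: "nc_cong N (descending_prod N k x * ascending_prod N k (- x)) 1" .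
      have "ascending_prod N k (- x) * descending_prod N k x = lin_factor k (- x) * ((ascending_prod N (Suc k) (- x) * descending_prod N (Suc k) x) * lin_factor k x)"
        using step by (simp add: ascending_prod_rec descending_prod_rec mult.assoc)
      also have "nc_cong N \<dots> (lin_factor k (- x) * (1 * lin_factor k x))"
        using step by (intro nc_cong_mult nc_cong_refl car) auto
      also have "nc_cong N \<dots> 1"
        using inv[of "- x"] by simp
      finally show ?case using 1 by blast
    qed
  qed (simp add: nc_cong_refl free_alg_1)
  then show "nc_cong N (descending_prod N k x * ascending_prod N k (- x)) 1" "nc_cong N (ascending_prod N k (- x) * descending_prod N k x) 1"
    by auto
qed

text \<open>The element \<open>\<xi>(T) = B\<^bsub>k+d-1\<^esub>(T\<^bsub>d-1\<^esub>) \<dots> B\<^sub>k(T\<^sub>0)\<close>. Indices start at 0, and \<open>N = k + d\<close> in all applications.\<close>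

definition stair_prod :: "nat \<Rightarrow> nat \<Rightarrow> nat \<Rightarrow> (nat \<Rightarrow> 'a::comm_ring_1) \<Rightarrow> (word \<Rightarrow>\<^sub>0 'a)" where
  "stair_prod N k d T = prod_list (map (\<lambda>r. ascending_prod N (k + r) (T r)) (rev [0..<d]))"

lemma stair_carrier: "1 \<le> k \<Longrightarrow> stair_prod N k d T \<in> carrier (free_alg N)"
  unfolding stair_prod_def by (auto intro!: free_alg_prod_list ascending_prod_carrier)

lemma stair_Suc: "stair_prod N k (Suc d) T = ascending_prod N (k + d) (T d) * stair_prod N k d T"
  by (simp add: stair_prod_def)

lemma stair_cong: "(\<And>r. r < d \<Longrightarrow> T r = T' r) \<Longrightarrow> stair_prod N k d T = stair_prod N k d T'"
  by (auto simp: stair_prod_def intro!: arg_cong[where f = prod_list])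

text \<open>For \<open>r = d - 1\<close> the value \<open>T d\<close>, which does not occur in \<open>stair_prod\<close>, is exchanged with \<open>T (d - 1)\<close>. The factor commutes with the factors
  of \<open>stair_prod\<close> to the left of the two that it affects.\<close>

lemma stair_exchange:
  assumes "1 \<le> k" "k + d = N" "r < d"
  shows "nc_cong N (lin_factor (k + r) (T (Suc r) - T r) * stair_prod N k d T) (stair_prod N k d (\<lambda>j. T (Transposition.transpose r (Suc r) j)))"
proof -
  let ?T = "\<lambda>j. T (Transposition.transpose r (Suc r) j)"
  have upper: "nc_cong N (lin_factor (k + r) (T (Suc r) - T r) * stair_prod N k e T) (stair_prod N k e ?T)"
    if "Suc (Suc r) \<le> e" "e \<le> d" for e
    using that
  proof (induction e rule: dec_induct)
    case base
    have lower: "stair_prod N k r ?T = stair_prod N k r T"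
      by (rule stair_cong) (auto simp: Transposition.transpose_def)
    have "lin_factor (k + r) (T (Suc r) - T r) * stair_prod N k (Suc (Suc r)) T
      = (lin_factor (k + r) (T (Suc r) - T r) * (ascending_prod N (Suc (k + r)) (T (Suc r)) * ascending_prod N (k + r) (T r))) * stair_prod N k r T"
      by (simp add: stair_Suc mult.assoc)
    also have "nc_cong N \<dots> ((ascending_prod N (Suc (k + r)) (T r) * ascending_prod N (k + r) (T (Suc r))) * stair_prod N k r T)"
      using assms by (intro nc_cong_mult nc_cong_refl stair_carrier ascending_prod_exchange) auto
    also have "(ascending_prod N (Suc (k + r)) (T r) * ascending_prod N (k + r) (T (Suc r))) * stair_prod N k r T = stair_prod N k (Suc (Suc r)) ?T"
      by (simp add: stair_Suc mult.assoc lower)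
    finally show ?case .
  next
    case (step e)
    let ?l = "lin_factor (k + r) (T (Suc r) - T r)"
    have "nc_cong N ((?l * ascending_prod N (k + e) (T e)) * stair_prod N k e T) ((ascending_prod N (k + e) (T e) * ?l) * stair_prod N k e T)"
      using assms step by (intro nc_cong_mult nc_cong_refl stair_carrier lin_factor_commute_ascending) auto
    also have "(ascending_prod N (k + e) (T e) * ?l) * stair_prod N k e T = ascending_prod N (k + e) (T e) * (?l * stair_prod N k e T)"
      by (simp add: mult.assoc)
    also have "nc_cong N \<dots> (ascending_prod N (k + e) (T e) * stair_prod N k e ?T)"
      using assms step by (intro nc_cong_mult nc_cong_refl ascending_prod_carrier) auto
    finally show ?case
      using step by (simp add: stair_Suc mult.assoc)
  qed
  show ?thesis
  proof (cases "Suc (Suc r) \<le> d")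
    case True
    then show ?thesis using upper by blast
  next
    case False
    with assms have d: "d = Suc r" by simp
    have lower: "stair_prod N k r ?T = stair_prod N k r T"
      by (rule stair_cong) (auto simp: Transposition.transpose_def)
    have ascending_prod: "ascending_prod N (k + r) c = lin_factor (k + r) c" for c :: 'a
      using assms d by (simp add: ascending_prod_rec)
    have "nc_cong N ((lin_factor (k + r) (T (Suc r) - T r) * lin_factor (k + r) (T r)) * stair_prod N k r T)
                    (lin_factor (k + r) (T (Suc r) - T r + T r) * stair_prod N k r T)"
      using assms d by (intro nc_cong_mult nc_cong_refl stair_carrier lin_factor_add) auto
    then show ?thesis
      by (simp add: d stair_Suc ascending_prod lower mult.assoc)
  qed
qed

section \<open>The word of maximal length in a product of linear factors\<close>

lemma word_sum_lin_mult:
  "word_sum S (lin_factor j x * f) = word_sum S f + x * word_sum {a. j # a \<in> S} f"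
  by (simp add: lin_factor_def distrib_right word_sum_simps mult.assoc free_gen_eq_u_word word_sum_u_word_mult)

text \<open>Expanding the product gives one word for each subset of the factors; the word of the whole product is the only one of full length.\<close>

lemma word_sum_lin_prod_short:
  assumes "\<And>a. a \<in> S \<Longrightarrow> length ps < length a"
  shows "word_sum S (prod_list (map (\<lambda>p. lin_factor (fst p) (snd p)) ps)) = 0"
  using assms
proof (induction ps arbitrary: S)
  case Nil
  then have "[] \<notin> S" by fastforce
  then show ?case
    using word_sum_u_word[of S "[]"] by (simp add: u_word_Nil)
next
  case (Cons p ps)
  have "word_sum S (prod_list (map (\<lambda>p. lin_factor (fst p) (snd p)) ps)) = 0"
    using Cons.prems by (intro Cons.IH) fastforce
  moreover have "word_sum {a. fst p # a \<in> S} (prod_list (map (\<lambda>p. lin_factor (fst p) (snd p)) ps)) = 0"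
    using Cons.prems by (intro Cons.IH) fastforce
  ultimately show ?case
    by (simp add: word_sum_lin_mult)
qed

lemma word_sum_lin_prod:
  assumes "\<And>a. a \<in> S \<Longrightarrow> length ps \<le> length a" "map fst ps \<in> S"
  shows "word_sum S (prod_list (map (\<lambda>p. lin_factor (fst p) (snd p)) ps)) = prod_list (map snd ps)"
  using assms
proof (induction ps arbitrary: S)
  case Nil
  then show ?case
    using word_sum_u_word[of S "[]"] by (simp add: u_word_Nil)
next
  case (Cons p ps)
  have "word_sum S (prod_list (map (\<lambda>p. lin_factor (fst p) (snd p)) ps)) = 0"
    using Cons.prems by (intro word_sum_lin_prod_short) fastforce
  moreover have "word_sum {a. fst p # a \<in> S} (prod_list (map (\<lambda>p. lin_factor (fst p) (snd p)) ps)) = prod_list (map snd ps)"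
    using Cons.prems by (intro Cons.IH) fastforce+
  ultimately show ?case
    by (simp add: word_sum_lin_mult)
qed

lemma stair_lin_prod:
  "stair_prod N k d T = prod_list (map (\<lambda>p. lin_factor (fst p) (snd p))
      (concat (map (\<lambda>r. map (\<lambda>j. (j, T r)) [k + r..<N]) (rev [0..<d]))))"
proof -
  have "prod_list (map (\<lambda>p. lin_factor (fst p) (snd p)) (concat (map (\<lambda>r. map (\<lambda>j. (j, T r)) [k + r..<N]) rs)))
     = prod_list (map (\<lambda>r. ascending_prod N (k + r) (T r)) rs)" for rs
    by (induction rs) (simp_all add: ascending_prod_def comp_def)
  then show ?thesis by (simp add: stair_prod_def)
qed

lemma word_sum_stair:
  assumes "k + d = N"
    and "\<And>a. a \<in> S \<Longrightarrow> length (stair_word k N) \<le> length a" "stair_word k N \<in> S"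
  shows "word_sum S (stair_prod N k d T) = (\<Prod>r<d. T r ^ (d - r))"
proof -
  let ?ps = "\<lambda>rs. concat (map (\<lambda>r. map (\<lambda>j. (j, T r)) [k + r..<N]) rs)"
  have "map fst (?ps rs) = concat (map (\<lambda>r. [k + r..<N]) rs)" for rs
    by (induction rs) (simp_all add: comp_def)
  moreover have "rev [k..<N] = map ((+) k) (rev [0..<d])"
    using assms(1) map_add_upt[of k d] by (simp add: add.commute rev_map[symmetric] cong: map_cong)
  ultimately have fst: "map fst (?ps (rev [0..<d])) = stair_word k N"
    by (simp add: stair_word_def comp_def)
  then have "length (?ps (rev [0..<d])) = length (stair_word k N)"
    by (simp only: length_map flip: fst)
  then have "word_sum S (stair_prod N k d T) = prod_list (map snd (?ps (rev [0..<d])))"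
    unfolding stair_lin_prod using assms fst by (intro word_sum_lin_prod) auto
  also have "prod_list (map snd (?ps rs)) = prod_list (map (\<lambda>r. T r ^ (N - (k + r))) rs)" for rs
    by (induction rs) (simp_all add: comp_def map_replicate_const)
  also have "prod_list (map (\<lambda>r. T r ^ (N - (k + r))) (rev [0..<d])) = (\<Prod>r\<in>set (rev [0..<d]). T r ^ (N - (k + r)))"
    by (rule prod.distinct_set_conv_list[symmetric]) simp
  also have "\<dots> = (\<Prod>r<d. T r ^ (d - r))"
    by (rule prod.cong) (auto simp flip: assms(1))
  finally show ?thesis .
qed

no_notation vec_index (infixl "$" 100)
unbundle fps_syntax

section \<open>Generating series of complete homogeneous polynomials\<close>

definition geometric_fps :: "'a::comm_ring_1 \<Rightarrow> 'a fps" where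
  "geometric_fps x = Abs_fps (\<lambda>n. x ^ n)"

lemma geometric_fps_nth: "geometric_fps x $ n = x ^ n"
  by (simp add: geometric_fps_def)

lemma geometric_fps_unfold: "geometric_fps x = 1 + fps_const x * fps_X * geometric_fps x"
proof (rule fps_ext)
  fix n show "geometric_fps x $ n = (1 + fps_const x * fps_X * geometric_fps x) $ n"
    by (cases n) (simp_all add: geometric_fps_def mult.assoc fps_X_mult_nth[of "geometric_fps x"] fps_X_mult_nth)
qed

lemma geometric_fps_inverse: "(1 - fps_const x * fps_X) * geometric_fps x = 1"
  using geometric_fps_unfold[of x] by (simp add: algebra_simps)

lemma geometric_fps_diff: "geometric_fps x - geometric_fps y = fps_const (x - y) * fps_X * (geometric_fps x * geometric_fps y)"
proof -
  have "geometric_fps x - geometric_fps y = geometric_fps x * ((1 - fps_const y * fps_X) * geometric_fps y) - ((1 - fps_const x * fps_X) * geometric_fps x) * geometric_fps y"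
    by (simp only: geometric_fps_inverse mult_1_left mult_1_right)
  also have "\<dots> = fps_const (x - y) * fps_X * (geometric_fps x * geometric_fps y)"
    by (simp add: algebra_simps flip: fps_const_sub)
  finally show ?thesis .
qed

definition int_coeff :: "'a::comm_ring_1 fps \<Rightarrow> int \<Rightarrow> 'a" where
  "int_coeff F p = (if p < 0 then 0 else F $ nat p)"

lemma int_coeff_add: "int_coeff (F + G) p = int_coeff F p + int_coeff G p"
  and int_coeff_const: "int_coeff (fps_const c * F) p = c * int_coeff F p"
  by (simp_all add: int_coeff_def)

lemma int_coeff_X: "int_coeff (fps_X * F) p = int_coeff F (p - 1)"
  by (auto simp: int_coeff_def fps_X_mult_nth nat_diff_distrib)

text \<open>The generating series of the complete homogeneous polynomials is \<open>\<Prod>(1 - x\<^sub>i X)\<^bsup>-1\<^esup>\<close>. Working with series makes the symmetry in the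
  variables and the adjunction of a variable automatic.\<close>

lemma complete_sym_eq_int_coeff:
  "complete_sym p xs = int_coeff (prod_list (map geometric_fps xs)) p"
proof (cases "p < 0")
  case False
  define E :: "nat \<Rightarrow> nat \<Rightarrow> nat list set" where "E l k = {e. length e = l \<and> sum_list e = k}" for l k
  have fin: "finite (E l k)" for l k
  proof (rule finite_subset)
    show "E l k \<subseteq> {e. set e \<subseteq> {..k} \<and> length e = l}"
      by (auto simp: E_def member_le_sum_list)
  qed (rule finite_lists_length_eq, simp)
  have "(\<Sum>e\<in>E (length xs) k. \<Prod>i<length xs. xs ! i ^ (e ! i)) = prod_list (map geometric_fps xs) $ k" for k
  proof (induction xs arbitrary: k)
    case Nil
    have "E 0 k = (if k = 0 then {[]} else {})"
      by (auto simp: E_def)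
    then show ?case by simp
  next
    case (Cons x xs)
    let ?F = "\<lambda>e. \<Prod>i<length xs. xs ! i ^ (e ! i)"
    have "(\<Sum>e\<in>E (length (x # xs)) k. \<Prod>i<length (x # xs). (x # xs) ! i ^ (e ! i))
        = (\<Sum>(i, e)\<in>Sigma {0..k} (\<lambda>i. E (length xs) (k - i)). x ^ i * ?F e)"
    proof (rule sum.reindex_bij_witness[of _ "\<lambda>(i, e). i # e" "\<lambda>e. (hd e, tl e)"])
      fix e assume "e \<in> E (length (x # xs)) k"
      then obtain i e' where "e = i # e'" "length e' = length xs" "i + sum_list e' = k"
        by (cases e) (auto simp: E_def)
      then show "(case (hd e, tl e) of (i, e) \<Rightarrow> i # e) = e"
        "(hd e, tl e) \<in> Sigma {0..k} (\<lambda>i. E (length xs) (k - i))"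
        "(case (hd e, tl e) of (i, e) \<Rightarrow> x ^ i * ?F e) = (\<Prod>i<length (x # xs). (x # xs) ! i ^ (e ! i))"
        by (auto simp: E_def prod.lessThan_Suc_shift simp del: prod.lessThan_Suc)
    qed (auto simp: E_def)
    also have "\<dots> = (\<Sum>i=0..k. x ^ i * (\<Sum>e\<in>E (length xs) (k - i). ?F e))"
      using fin by (subst sum.Sigma[symmetric]) (auto simp: sum_distrib_left)
    also have "\<dots> = prod_list (map geometric_fps (x # xs)) $ k"
      by (simp add: Cons.IH fps_mult_nth geometric_fps_nth)
    finally show ?case .
  qed
  with False show ?thesis
    by (simp add: complete_sym_def int_coeff_def E_def)
qed (simp add: complete_sym_def int_coeff_def)

section \<open>Determinants of shifted coefficients\<close>

text \<open>Row \<open>r\<close> is given by a series, from which the entries are read off as consecutive coefficients. With indices from 0 and \<open>d = n - 1\<close>, the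
  degree \<open>n - 2i + j\<close> becomes \<open>d + s - 2 r\<close>. It drops by two from one row to the next, so \<open>X\<^sup>2\<close> times the series of row \<open>r + 1\<close> has
  row \<open>r + 1\<close> as its entries in row \<open>r\<close>.\<close>

definition shifted_det :: "nat \<Rightarrow> (nat \<Rightarrow> 'a::comm_ring_1 fps) \<Rightarrow> 'a" where
  "shifted_det d F = det (mat d d (\<lambda>(r, s). int_coeff (F r) (int d + int s - 2 * int r)))"

lemma shifted_det_cong: "(\<And>r. r < d \<Longrightarrow> F r = G r) \<Longrightarrow> shifted_det d F = shifted_det d G"
  unfolding shifted_det_def by (intro arg_cong[where f = det] eq_matI) auto

lemma shifted_det_leibniz:
  "shifted_det d F = (\<Sum>p | p permutes {0..<d}. signof p * (\<Prod>r<d. int_coeff (F r) (int d + int (p r) - 2 * int r)))"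
  unfolding shifted_det_def det_def
  by (auto intro!: sum.cong prod.cong simp: atLeast0LessThan permutes_in_image)

lemma prod_row_upd:
  fixes d :: nat and q :: "nat \<Rightarrow> int"
  assumes "r < d"
  shows "(\<Prod>i<d. int_coeff ((F(r := C)) i) (q i)) = int_coeff C (q r) * (\<Prod>i\<in>{..<d} - {r}. int_coeff (F i) (q i))"
  using assms by (subst prod.remove[of _ r]) (auto intro!: prod.cong)

lemma shifted_det_add:
  assumes "r < d"
  shows "shifted_det d (F(r := A + B)) = shifted_det d (F(r := A)) + shifted_det d (F(r := B))"
  unfolding shifted_det_leibniz prod_row_upd[OF assms]
  by (simp add: int_coeff_add distrib_left distrib_right sum.distrib)

lemma shifted_det_scale:
  assumes "r < d"
  shows "shifted_det d (F(r := fps_const c * A)) = c * shifted_det d (F(r := A))"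
  unfolding shifted_det_leibniz prod_row_upd[OF assms]
  by (simp add: int_coeff_const sum_distrib_left mult.assoc mult.left_commute)

lemma shifted_det_next_row:
  assumes "r < d" "Suc r < d \<Longrightarrow> G = F (Suc r)"
  shows "shifted_det d (F(r := A + fps_const c * (fps_X * (fps_X * G)))) = shifted_det d (F(r := A))"
proof (cases "Suc r < d")
  case True
  let ?M = "mat d d (\<lambda>(i, s). int_coeff ((F(r := A)) i) (int d + int s - 2 * int i))"
  have "mat d d (\<lambda>(i, s). int_coeff ((F(r := A + fps_const c * (fps_X * (fps_X * G)))) i) (int d + int s - 2 * int i))
      = addrow c r (Suc r) ?M"
    using True assms by (intro eq_matI) (auto simp: int_coeff_add int_coeff_const int_coeff_X algebra_simps)
  then show ?thesis
    using True by (simp add: shifted_det_def det_addrow[of _ d])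
next
  case False
  \<comment> \<open>The entries of the last row are coefficients of degree at most 1, so that \<open>X\<^sup>2\<close> kills them.\<close>
  with assms have d: "d = Suc r" by simp
  have "int_coeff (A + fps_const c * (fps_X * (fps_X * G))) (int d + int s - 2 * int r) = int_coeff A (int d + int s - 2 * int r)"
    if "s < d" for s
    using that d by (simp add: int_coeff_add int_coeff_const int_coeff_X) (simp add: int_coeff_def)
  then show ?thesis
    unfolding shifted_det_def by (intro arg_cong[where f = det] eq_matI) auto
qed

lemma int_coeff_mult_poly:
  assumes "\<And>k. k > s \<Longrightarrow> P $ k = 0"
  shows "int_coeff (F * P) (q + int s) = (\<Sum>j\<le>s. int_coeff F (q + int j) * P $ (s - j))"
proof (cases "q + int s < 0")
  case True
  then show ?thesis by (auto simp: int_coeff_def intro!: sum.neutral[symmetric])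
next
  case False
  define l where "l = nat (q + int s)"
  have l: "q + int s = int l" using False by (simp add: l_def)
  have "int_coeff (F * P) (q + int s) = (\<Sum>i\<in>{0..l}. F $ i * P $ (l - i))"
    by (simp add: l int_coeff_def fps_mult_nth)
  also have "\<dots> = (\<Sum>i\<in>{i\<in>{0..l}. l - i \<le> s}. F $ i * P $ (l - i))"
    using assms by (intro sum.mono_neutral_right) (auto, metis mult_zero_right not_le)
  also have "\<dots> = (\<Sum>j\<in>{j\<in>{..s}. 0 \<le> q + int j}. int_coeff F (q + int j) * P $ (s - j))"
  proof (rule sum.reindex_bij_witness[of _ "\<lambda>j. nat (q + int j)" "\<lambda>i. nat (int i - q)"])
    fix i assume "i \<in> {i\<in>{0..l}. l - i \<le> s}"
    then have i: "i \<le> l" "l \<le> i + s" by auto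
    with l have j: "int i - q \<ge> 0" "int i - q \<le> int s" by linarith+
    from j show "nat (q + int (nat (int i - q))) = i" by simp
    from j show "nat (int i - q) \<in> {j\<in>{..s}. 0 \<le> q + int j}" by auto
    have "s - nat (int i - q) = l - i" using j l i by linarith
    with j show "int_coeff F (q + int (nat (int i - q))) * P $ (s - nat (int i - q)) = F $ i * P $ (l - i)"
      by (simp add: int_coeff_def)
  next
    fix j assume "j \<in> {j\<in>{..s}. 0 \<le> q + int j}"
    with l show "nat (int (nat (q + int j)) - q) = j" "nat (q + int j) \<in> {i\<in>{0..l}. l - i \<le> s}"
      by auto
  qed
  also have "\<dots> = (\<Sum>j\<le>s. int_coeff F (q + int j) * P $ (s - j))"
    by (intro sum.mono_neutral_left) (auto simp: int_coeff_def)
  finally show ?thesis .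
qed

lemma linear_factors_nth:
  fixes t :: "nat \<Rightarrow> 'a::comm_ring_1"
  assumes "finite J"
  shows "k > card J \<Longrightarrow> (\<Prod>j\<in>J. 1 - fps_const (t j) * fps_X) $ k = 0"
    and "(\<Prod>j\<in>J. 1 - fps_const (t j) * fps_X) $ 0 = 1"
  using assms
proof (induction J arbitrary: k rule: finite_induct)
  case (insert j J)
  {
    case 1
    then obtain k' where "k = Suc k'" by (cases k) auto
    with 1 insert show ?case
      by (simp add: left_diff_distrib mult.assoc fps_X_mult_nth)
  next
    case 2
    with insert show ?case
      by (simp add: left_diff_distrib mult.assoc fps_X_mult_nth)
  }
qed simp_all

text \<open>Multiplying the matrix by the unitriangular matrix of the coefficients of \<open>\<Prod>j<s. (1 - t\<^sub>j X)\<close> cancels, in column \<open>s\<close>, the series of the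
  first \<open>s\<close> variables. Above the diagonal this leaves polynomials of too small a degree, and on the diagonal the series of \<open>t\<^sub>r\<close>.\<close>

lemma shifted_det_geo:
  fixes t :: "nat \<Rightarrow> 'a::comm_ring_1"
  shows "shifted_det d (\<lambda>r. \<Prod>j\<le>r. geometric_fps (t j)) = (\<Prod>r<d. t r ^ (d - r))"
proof -
  define P where "P s = (\<Prod>j<s. 1 - fps_const (t j) * fps_X)" for s
  define G where "G r = (\<Prod>j\<le>r. geometric_fps (t j))" for r
  define M where "M = mat d d (\<lambda>(r, s). int_coeff (G r) (int d + int s - 2 * int r))"
  define U where "U = mat d d (\<lambda>(i, s). if i \<le> s then P s $ (s - i) else 0)"
  have P: "P s $ k = 0" if "k > s" for s k
    using linear_factors_nth(1)[of "{..<s}" k t] that by (simp add: P_def)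
  have P0: "P s $ 0 = 1" for s
    using linear_factors_nth(2)[of "{..<s}" t] by (simp add: P_def)
  have carrier: "M \<in> carrier_mat d d" "U \<in> carrier_mat d d"
    by (simp_all add: M_def U_def)
  have entry: "(M * U) $$ (r, s) = int_coeff (G r * P s) (int d + int s - 2 * int r)" if "r < d" "s < d" for r s
  proof -
    have "(M * U) $$ (r, s) = (\<Sum>i<d. int_coeff (G r) (int d + int i - 2 * int r) * (if i \<le> s then P s $ (s - i) else 0))"
      using that by (simp add: M_def U_def scalar_prod_def atLeast0LessThan)
    also have "\<dots> = (\<Sum>i\<le>s. int_coeff (G r) ((int d - 2 * int r) + int i) * P s $ (s - i))"
      using that by (intro sum.mono_neutral_cong_right) (auto simp: algebra_simps)
    also have "\<dots> = int_coeff (G r * P s) ((int d - 2 * int r) + int s)"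
      by (rule int_coeff_mult_poly[symmetric]) (rule P)
    finally show ?thesis by (simp add: algebra_simps)
  qed
  have cancel: "(\<Prod>j\<in>J. geometric_fps (t j)) * (\<Prod>j\<in>J. 1 - fps_const (t j) * fps_X) = 1" for J
    by (simp add: prod.distrib[symmetric] mult.commute[of "geometric_fps _"] geometric_fps_inverse)
  have upper: "(M * U) $$ (r, s) = 0" if "r < s" "s < d" for r s
  proof -
    have split: "{..<s} = {..r} \<union> {Suc r..<s}" using that by auto
    have "P s = (\<Prod>j\<le>r. 1 - fps_const (t j) * fps_X) * (\<Prod>j=Suc r..<s. 1 - fps_const (t j) * fps_X)"
      unfolding P_def split by (rule prod.union_disjoint) auto
    then have "G r * P s = (\<Prod>j=Suc r..<s. 1 - fps_const (t j) * fps_X)"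
      using cancel[of "{..r}"] by (simp add: G_def flip: mult.assoc)
    then have "int_coeff (G r * P s) (int d + int s - 2 * int r) = 0"
      using that linear_factors_nth(1)[of "{Suc r..<s}" "nat (int d + int s - 2 * int r)" t]
      by (auto simp: int_coeff_def)
    with that entry show ?thesis by simp
  qed
  have diag: "(M * U) $$ (r, r) = t r ^ (d - r)" if "r < d" for r
  proof -
    have "{..r} = insert r {..<r}" by auto
    then have "G r * P r = geometric_fps (t r)"
      using cancel[of "{..<r}"] by (simp add: G_def P_def mult.assoc)
    then show ?thesis
      using entry[OF that that] that by (simp add: int_coeff_def geometric_fps_def nat_diff_distrib)
  qed
  have "det (M * U) = prod_list (diag_mat (M * U))"
    using carrier by (intro det_lower_triangular[of d] upper mult_carrier_mat[of _ d d])
  also have "\<dots> = (\<Prod>r<d. t r ^ (d - r))"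
    using carrier by (simp add: prod_list_diag_prod diag atLeast0LessThan del: index_mult_mat(1))
  finally have MU: "det M * det U = (\<Prod>r<d. t r ^ (d - r))"
    using det_mult[OF carrier] by simp
  have "det U = prod_list (diag_mat U)"
    using carrier by (intro det_upper_triangular[of _ d]) (auto simp: U_def)
  then have "det U = 1"
    by (simp add: prod_list_diag_prod U_def P0)
  with MU show ?thesis
    by (simp add: shifted_det_def M_def G_def)
qed

section \<open>Building up the determinant one factor at a time\<close>

text \<open>The condition under which values at the transposed sequences determine divided differences. The index \<open>d\<close> is included because \<open>T d\<close> enters through the last
  exchange.\<close>

definition generic :: "nat \<Rightarrow> (nat \<Rightarrow> 'a::comm_ring_1) \<Rightarrow> bool" where
  "generic d T \<longleftrightarrow> (\<forall>i\<le>d. \<forall>j\<le>d. i \<noteq> j \<longrightarrow> (\<forall>f. (T i - T j) * f = 0 \<longrightarrow> f = 0))"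

lemma generic_cancel:
  assumes "generic d T" "r < d" "(T (Suc r) - T r) * a = (T (Suc r) - T r) * b"
  shows "a = b"
proof -
  have "(T (Suc r) - T r) * (a - b) = 0"
    using assms(3) by (simp add: right_diff_distrib)
  moreover have "Suc r \<le> d" "r \<le> d" "Suc r \<noteq> r"
    using assms(2) by auto
  ultimately have "a - b = 0"
    using assms(1) unfolding generic_def by blast
  then show ?thesis by simp
qed

lemma generic_swap:
  assumes "generic d T" "r < d"
  shows "generic d (\<lambda>j. T (Transposition.transpose r (Suc r) j))"
proof -
  let ?s = "Transposition.transpose r (Suc r)"
  have le: "?s i \<le> d" if "i \<le> d" for i
    using that assms(2) by (auto simp: Transposition.transpose_def)
  have neq: "?s i \<noteq> ?s j" if "i \<noteq> j" for i j
    using that by (auto simp: Transposition.transpose_def split: if_splits)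
  show ?thesis
    unfolding generic_def
    using assms(1)[unfolded generic_def, rule_format, OF le le neq] by blast
qed

text \<open>The series of \<open>t\<^sub>0, \<dots>, t\<^sub>i\<close> is symmetric in \<open>t\<^sub>r, t\<^bsub>r+1\<^esub>\<close> unless \<open>i = r\<close>, and in that case its divided difference is \<open>X\<close> times the
  series with one more variable.\<close>

lemma prod_geometric_fps_swap:
  fixes T :: "nat \<Rightarrow> 'a::comm_ring_1"
  shows "i \<noteq> r \<Longrightarrow> (\<Prod>j\<le>i. geometric_fps (T (Transposition.transpose r (Suc r) j))) = (\<Prod>j\<le>i. geometric_fps (T j))"
    and "(\<Prod>j\<le>r. geometric_fps (T (Transposition.transpose r (Suc r) j)))
       = (\<Prod>j\<le>r. geometric_fps (T j)) + fps_const (T (Suc r) - T r) * (fps_X * (\<Prod>j\<le>Suc r. geometric_fps (T j)))"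
proof -
  let ?s = "Transposition.transpose r (Suc r)"
  show "(\<Prod>j\<le>i. geometric_fps (T (?s j))) = (\<Prod>j\<le>i. geometric_fps (T j))" if "i \<noteq> r"
  proof (cases "i < r")
    case True
    then show ?thesis
      by (intro prod.cong) (auto simp: Transposition.transpose_def)
  next
    case False
    with that have "?s permutes {..i}"
      by (intro permutes_swap_id) auto
    from prod.permute[OF this, of "\<lambda>j. geometric_fps (T j)"] show ?thesis
      by (simp add: comp_def)
  qed
  have low: "(\<Prod>j<r. geometric_fps (T (?s j))) = (\<Prod>j<r. geometric_fps (T j))"
    by (intro prod.cong) (auto simp: Transposition.transpose_def)
  have split: "(\<Prod>j\<le>r. f j) = (\<Prod>j<r. f j) * f r" for f :: "nat \<Rightarrow> 'a fps"
    by (simp flip: lessThan_Suc_atMost)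
  have b: "geometric_fps (T (Suc r)) = geometric_fps (T r) + fps_const (T (Suc r) - T r) * fps_X * (geometric_fps (T (Suc r)) * geometric_fps (T r))"
    using geometric_fps_diff[of "T (Suc r)" "T r"] by (simp add: algebra_simps)
  have "(\<Prod>j\<le>r. geometric_fps (T (?s j))) = (\<Prod>j<r. geometric_fps (T j)) * geometric_fps (T (Suc r))"
    by (simp add: split low)
  also have "\<dots> = (\<Prod>j<r. geometric_fps (T j)) * (geometric_fps (T r) + fps_const (T (Suc r) - T r) * fps_X * (geometric_fps (T (Suc r)) * geometric_fps (T r)))"
    by (subst b) simp
  also have "\<dots> = (\<Prod>j\<le>r. geometric_fps (T j)) + fps_const (T (Suc r) - T r) * (fps_X * (\<Prod>j\<le>Suc r. geometric_fps (T j)))"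
    by (simp only: prod.atMost_Suc split) (simp add: algebra_simps)
  finally show "(\<Prod>j\<le>r. geometric_fps (T (?s j)))
       = (\<Prod>j\<le>r. geometric_fps (T j)) + fps_const (T (Suc r) - T r) * (fps_X * (\<Prod>j\<le>Suc r. geometric_fps (T j)))" .
qed

text \<open>The statement that is propagated along the factors: \<open>g r\<close> is the generating series of the alphabet adjoined to row \<open>r\<close>. The value
  is required for all generic \<open>T\<close>, because a step compares \<open>T\<close> with a transposed sequence.\<close>

definition represents ::
  "nat list set \<Rightarrow> nat \<Rightarrow> nat \<Rightarrow> (word \<Rightarrow>\<^sub>0 'a::comm_ring_1) \<Rightarrow> (nat \<Rightarrow> 'a fps) \<Rightarrow> bool" where
  "represents S k d P g \<longleftrightarrow> P \<in> carrier (free_alg (k + d)) \<and>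
     (\<forall>T. generic d T \<longrightarrow>
        word_sum S (P * stair_prod (k + d) k d T) = shifted_det d (\<lambda>r. (\<Prod>j\<le>r. geometric_fps (T j)) * g r))"

lemma word_sum_lin_middle:
  "word_sum S (P * (lin_factor j x * Q)) = word_sum S (P * Q) + x * word_sum S (P * (free_gen j * Q))"
  by (simp add: lin_factor_def distrib_left distrib_right mult.assoc free_scalar_left_comm word_sum_simps)

text \<open>The variable \<open>x\<close> is adjoined to row \<open>r\<close>, provided that row \<open>r + 1\<close> already has the alphabet of row \<open>r\<close> with \<open>x\<close> adjoined. This makes
  the error term a multiple of row \<open>r + 1\<close>.\<close>

lemma represents_lin:
  fixes P :: "word \<Rightarrow>\<^sub>0 'a::comm_ring_1"
  assumes S: "nil_closed S" and k: "1 \<le> k" and r: "r < d" and P: "represents S k d P g"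
    and next_row: "Suc r < d \<Longrightarrow> g (Suc r) = g r * geometric_fps x"
  shows "represents S k d (P * lin_factor (k + r) x) (g(r := g r * geometric_fps x))"
  unfolding represents_def
proof (intro conjI allI impI)
  show "P * lin_factor (k + r) x \<in> carrier (free_alg (k + d))"
    using P k r by (auto simp: represents_def intro!: free_alg_mult lin_factor_carrier)
next
  fix T :: "nat \<Rightarrow> 'a" assume T: "generic d T"
  define H where "H i = (\<Prod>j\<le>i. geometric_fps (T j))" for i
  define F where "F i = H i * g i" for i
  define K where "K = H (Suc r) * g r"
  let ?st = "stair_prod (k + d) k d"
  let ?s = "\<lambda>j. T (Transposition.transpose r (Suc r) j)"
  let ?\<delta> = "T (Suc r) - T r"
  let ?L = "word_sum S (P * ?st T)"
  let ?Lu = "word_sum S (P * (free_gen (k + r) * ?st T))"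
  have at: "word_sum S (P * ?st T') = shifted_det d (\<lambda>r. (\<Prod>j\<le>r. geometric_fps (T' j)) * g r)" if "generic d T'" for T'
    using P that by (simp add: represents_def)
  have L: "?L = shifted_det d F"
    using at[OF T] by (simp add: F_def[abs_def] H_def)
  have "?L + ?\<delta> * ?Lu = word_sum S (P * (lin_factor (k + r) ?\<delta> * ?st T))"
    by (simp add: word_sum_lin_middle)
  also have "\<dots> = word_sum S (P * ?st ?s)"
    using P k r by (intro word_sum_cong[OF S, of "k + d"] nc_cong_mult[OF nc_cong_refl] stair_exchange)
      (auto simp: represents_def)
  also have "\<dots> = shifted_det d (\<lambda>r. (\<Prod>j\<le>r. geometric_fps (?s j)) * g r)"
    by (rule at[OF generic_swap[OF T r]])
  also have "(\<lambda>r. (\<Prod>j\<le>r. geometric_fps (?s j)) * g r) = F(r := F r + fps_const ?\<delta> * (fps_X * K))"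
    by (rule ext) (auto simp: F_def H_def K_def prod_geometric_fps_swap distrib_right mult.assoc)
  also have "shifted_det d \<dots> = shifted_det d F + ?\<delta> * shifted_det d (F(r := fps_X * K))"
    using shifted_det_add[OF r, of F "F r"] shifted_det_scale[OF r, of F] by simp
  finally have "?\<delta> * ?Lu = ?\<delta> * shifted_det d (F(r := fps_X * K))"
    by (simp add: L)
  then have Lu: "?Lu = shifted_det d (F(r := fps_X * K))"
    by (rule generic_cancel[OF T r])
  have Hr: "H (Suc r) = H r * geometric_fps (T (Suc r))"
    by (simp add: H_def)
  have row: "F r * geometric_fps x = (F r + fps_const x * (fps_X * K)) + fps_const (x * (x - T (Suc r))) * (fps_X * (fps_X * (K * geometric_fps x)))"
  proof -
    have K: "K = F r * geometric_fps (T (Suc r))"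
      by (simp add: K_def F_def Hr mult_ac)
    have 1: "F r * geometric_fps x = F r + fps_const x * (fps_X * (F r * geometric_fps x))"
      by (subst geometric_fps_unfold) (simp add: algebra_simps)
    have 2: "F r * geometric_fps x = K + fps_const (x - T (Suc r)) * (fps_X * (K * geometric_fps x))"
      using arg_cong[OF geometric_fps_diff[of x "T (Suc r)"], of "(*) (F r)"] by (simp add: K algebra_simps)
    have "F r * geometric_fps x = F r + fps_const x * (fps_X * (K + fps_const (x - T (Suc r)) * (fps_X * (K * geometric_fps x))))"
      by (subst 1) (simp only: 2)
    then show ?thesis
      by (simp only: distrib_left mult_ac fps_const_mult[symmetric] add_ac)
  qed
  have "word_sum S (P * lin_factor (k + r) x * ?st T) = shifted_det d F + x * shifted_det d (F(r := fps_X * K))"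
    by (simp add: mult.assoc word_sum_lin_middle L Lu)
  also have "\<dots> = shifted_det d (F(r := F r + fps_const x * (fps_X * K)))"
    using shifted_det_add[OF r, of F "F r"] shifted_det_scale[OF r, of F] by simp
  also have "\<dots> = shifted_det d (F(r := F r * geometric_fps x))"
    unfolding row using next_row by (intro shifted_det_next_row[OF r, symmetric]) (simp add: F_def K_def mult.assoc)
  also have "F(r := F r * geometric_fps x) = (\<lambda>i. (\<Prod>j\<le>i. geometric_fps (T j)) * (g(r := g r * geometric_fps x)) i)"
    by (auto simp: F_def H_def mult.assoc)
  finally show "word_sum S (P * lin_factor (k + r) x * ?st T)
      = shifted_det d (\<lambda>i. (\<Prod>j\<le>i. geometric_fps (T j)) * (g(r := g r * geometric_fps x)) i)" .
qed

lemma represents_cong: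
  assumes "represents S k d P g" "\<And>i. i < d \<Longrightarrow> g i = g' i"
  shows "represents S k d P g'"
proof -
  have "shifted_det d (\<lambda>r. (\<Prod>j\<le>r. geometric_fps (T j)) * g r) = shifted_det d (\<lambda>r. (\<Prod>j\<le>r. geometric_fps (T j)) * g' r)" for T
    using assms(2) by (intro shifted_det_cong) simp
  with assms(1) show ?thesis
    by (simp add: represents_def)
qed

text \<open>The letters descend, so that each row is treated when the row below it has already got \<open>x\<close>.\<close>

lemma represents_descending:
  assumes S: "nil_closed S" and k: "1 \<le> k" and P: "represents S k d P g"
    and r: "r \<le> d" and const: "\<And>i. r \<le> i \<Longrightarrow> Suc i < d \<Longrightarrow> g (Suc i) = g i"
  shows "represents S k d (P * descending_prod (k + d) (k + r) x) (\<lambda>i. if r \<le> i then g i * geometric_fps x else g i)"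
proof -
  have "represents S k d (P * descending_prod (k + d) (k + j) x) (\<lambda>i. if j \<le> i then g i * geometric_fps x else g i)"
    if "r \<le> j" "j \<le> d" for j
    using that(2,1)
  proof (induction j rule: inc_induct)
    case base
    have "represents S k d P (\<lambda>i. if d \<le> i then g i * geometric_fps x else g i)"
      by (rule represents_cong[OF P]) simp
    then show ?case by simp
  next
    case (step j)
    have "represents S k d (P * descending_prod (k + d) (k + Suc j) x * lin_factor (k + j) x)
      ((\<lambda>i. if Suc j \<le> i then g i * geometric_fps x else g i)(j := (if Suc j \<le> j then g j * geometric_fps x else g j) * geometric_fps x))"
      using step const[of j] by (intro represents_lin[OF S k]) auto
    moreover have "P * descending_prod (k + d) (k + Suc j) x * lin_factor (k + j) x = P * descending_prod (k + d) (k + j) x"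
      using step descending_prod_rec[of "k + j" "k + d" x] by (simp add: mult.assoc)
    moreover have "(\<lambda>i. if Suc j \<le> i then g i * geometric_fps x else g i)(j := (if Suc j \<le> j then g j * geometric_fps x else g j) * geometric_fps x)
        = (\<lambda>i. if j \<le> i then g i * geometric_fps x else g i)"
      by (rule ext) auto
    ultimately show ?case by simp
  qed
  from this[OF order_refl r] show ?thesis .
qed

lemma represents_low_lin:
  assumes low: "\<And>a. a \<in> S \<Longrightarrow> set a \<subseteq> {k..}" and P: "represents S k d P g" and j: "1 \<le> j" "j < k"
  shows "represents S k d (P * lin_factor j x) g"
proof -
  have "word_sum S (u_word p * free_gen j * u_word q) = (0 :: 'a)" for p q
  proof -
    have "p @ [j] @ q \<notin> S"
      using low[of "p @ [j] @ q"] j by auto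
    then show ?thesis
      by (simp add: free_gen_eq_u_word word_sum_u_word flip: u_word_append)
  qed
  then have "word_sum S (P * (free_gen j * Q)) = 0" for Q
    using word_sum_two_sided_eq_0[of S "free_gen j" P Q] by (simp add: mult.assoc)
  then show ?thesis
    using P j by (auto simp: represents_def mult.assoc word_sum_lin_middle intro!: free_alg_mult lin_factor_carrier)
qed

lemma represents_low_descending:
  assumes S: "nil_closed S" and low: "\<And>a. a \<in> S \<Longrightarrow> set a \<subseteq> {k..}" and P: "represents S k d P g"
    and const: "\<And>i. Suc i < d \<Longrightarrow> g (Suc i) = g i" and j: "1 \<le> j" "j \<le> k"
  shows "represents S k d (P * descending_prod (k + d) j x) (\<lambda>i. g i * geometric_fps x)"
  using j(2,1)
proof (induction j rule: inc_induct)
  case base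
  then show ?case
    using represents_descending[OF S _ P, of 0 x] const by simp
next
  case (step j)
  then have "descending_prod (k + d) j x = descending_prod (k + d) (Suc j) x * lin_factor j x"
    by (intro descending_prod_rec) simp
  with step low show ?case
    using represents_low_lin[of S k d "P * descending_prod (k + d) (Suc j) x" _ j x] by (simp add: mult.assoc)
qed

lemma represents_1:
  assumes "1 \<le> k" "\<And>a. a \<in> S \<Longrightarrow> length (stair_word k (k + d)) \<le> length a" "stair_word k (k + d) \<in> S"
  shows "represents S k d 1 (\<lambda>_. 1)"
  using assms by (auto simp: represents_def free_alg_1 shifted_det_geo word_sum_stair)

lemma represents_product:
  assumes S: "nil_closed S" and low: "\<And>a. a \<in> S \<Longrightarrow> set a \<subseteq> {Suc m..}"
    and minimal: "\<And>a. a \<in> S \<Longrightarrow> length (stair_word (Suc m) (Suc m + d)) \<le> length a"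
    and word: "stair_word (Suc m) (Suc m + d) \<in> S"
  shows "represents S (Suc m) d
     (prod_list (map (\<lambda>k. descending_prod (Suc m + d) k (\<omega> k)) [1..<Suc m])
       * prod_list (map (\<lambda>k. descending_prod (Suc m + d) (m + k) (y k)) [1..<Suc d]))
     (\<lambda>r. prod_list (map (\<lambda>k. geometric_fps (\<omega> k)) [1..<Suc m]) * prod_list (map (\<lambda>k. geometric_fps (y k)) [1..<Suc (Suc r)]))"
proof -
  let ?N = "Suc m + d"
  let ?W = "\<lambda>j. prod_list (map (\<lambda>k. descending_prod ?N k (\<omega> k)) [1..<Suc j])"
  let ?V = "\<lambda>j. prod_list (map (\<lambda>k. descending_prod ?N (m + k) (y k)) [1..<Suc j])"
  let ?w = "\<lambda>j. prod_list (map (\<lambda>k. geometric_fps (\<omega> k)) [1..<Suc j])"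
  let ?v = "\<lambda>j. prod_list (map (\<lambda>k. geometric_fps (y k)) [1..<Suc j])"
  have W: "represents S (Suc m) d (?W j) (\<lambda>_. ?w j)" if "j \<le> m" for j
    using that
  proof (induction j)
    case 0
    show ?case
      using represents_1[OF _ minimal word] by simp
  next
    case (Suc j)
    have "represents S (Suc m) d (?W j * descending_prod ?N (Suc j) (\<omega> (Suc j))) (\<lambda>_. ?w j * geometric_fps (\<omega> (Suc j)))"
      using Suc by (intro represents_low_descending[OF S low]) auto
    then show ?case by simp
  qed
  have V: "represents S (Suc m) d (?W m * ?V j) (\<lambda>r. ?w m * ?v (min (Suc r) j))" if "j \<le> d" for j
    using that
  proof (induction j)
    case 0
    show ?case using W[of m] by simp
  next
    case (Suc j)
    have "represents S (Suc m) d (?W m * ?V j * descending_prod ?N (Suc m + j) (y (Suc j)))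
        (\<lambda>r. if j \<le> r then ?w m * ?v (min (Suc r) j) * geometric_fps (y (Suc j)) else ?w m * ?v (min (Suc r) j))"
      using Suc by (intro represents_descending[OF S]) auto
    moreover have "(\<lambda>r. if j \<le> r then ?w m * ?v (min (Suc r) j) * geometric_fps (y (Suc j)) else ?w m * ?v (min (Suc r) j))
        = (\<lambda>r. ?w m * ?v (min (Suc r) (Suc j)))"
      by (rule ext) (auto simp: min_def le_Suc_eq mult.assoc)
    ultimately show ?case by (simp add: mult.assoc)
  qed
  show ?thesis
    by (rule represents_cong[OF V[OF order_refl]]) simp
qed

section \<open>Differences of variables are not zero divisors\<close>

lemma lookup_monomial_mult:
  fixes f :: "('a::cancel_comm_monoid_add) \<Rightarrow>\<^sub>0 'k::comm_ring_1"
  shows "Poly_Mapping.lookup (Poly_Mapping.single e 1 * f) (e + k) = Poly_Mapping.lookup f k"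
    and "(\<And>k. l \<noteq> e + k) \<Longrightarrow> Poly_Mapping.lookup (Poly_Mapping.single e 1 * f) l = 0"
proof -
  have "Poly_Mapping.single e 1 * f = (\<Sum>k\<in>Poly_Mapping.keys f. Poly_Mapping.single (e + k) (Poly_Mapping.lookup f k))"
    by (subst (1) poly_mapping_sum_single[of f]) (simp add: sum_distrib_left mult_single)
  then have *: "Poly_Mapping.lookup (Poly_Mapping.single e 1 * f) l
      = (\<Sum>k\<in>Poly_Mapping.keys f. if e + k = l then Poly_Mapping.lookup f k else 0)" for l
    by (auto simp: lookup_sum lookup_single when_def intro!: sum.cong)
  show "Poly_Mapping.lookup (Poly_Mapping.single e 1 * f) (e + k) = Poly_Mapping.lookup f k"
    by (simp add: * sum.delta in_keys_iff)
  show "Poly_Mapping.lookup (Poly_Mapping.single e 1 * f) l = 0" if "\<And>k. l \<noteq> e + k"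
    unfolding * using that by (intro sum.neutral) auto
qed

text \<open>If \<open>(u - v) f = 0\<close>, then the coefficient of \<open>f\<close> at a monomial \<open>k\<close> equals the one at \<open>k u / v\<close>, or 0 if \<open>v\<close> does not divide \<open>k\<close>. The
  exponent of \<open>v\<close> decreases until the second case applies.\<close>

lemma poly_var_diff_cancel:
  fixes f :: "'k::comm_ring_1 omega_y_z_poly"
  assumes "u \<noteq> v" "(poly_var u - poly_var v) * f = 0"
  shows "f = 0"
proof (rule poly_mapping_eqI)
  fix k
  let ?e = "\<lambda>v. Poly_Mapping.single v (1 :: nat)"
  have eq: "poly_var u * f = poly_var v * f"
    using assms(2) by (simp add: left_diff_distrib)
  have "Poly_Mapping.lookup f k = 0" if "Poly_Mapping.lookup k v = a" for a k
    using that
  proof (induction a arbitrary: k)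
    case 0
    have "Poly_Mapping.lookup f k = Poly_Mapping.lookup (poly_var u * f) (?e u + k)"
      by (simp add: poly_var_def lookup_monomial_mult)
    also have "\<dots> = Poly_Mapping.lookup (poly_var v * f) (?e u + k)"
      by (simp only: eq)
    also have "\<dots> = 0"
      unfolding poly_var_def
    proof (rule lookup_monomial_mult(2))
      fix l
      have "Poly_Mapping.lookup (?e u + k) v = 0"
        using 0 assms(1) by (simp add: lookup_add lookup_single)
      moreover have "Poly_Mapping.lookup (?e v + l) v \<noteq> 0"
        by (simp add: lookup_add lookup_single)
      ultimately show "?e u + k \<noteq> ?e v + l" by metis
    qed
    finally show ?case .
  next
    case (Suc a)
    define l where "l = k - ?e v"
    have k: "k = ?e v + l"
      unfolding l_def using Suc.prems
      by (intro poly_mapping_eqI) (auto simp: lookup_add lookup_minus lookup_single when_def)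
    have "Poly_Mapping.lookup (?e u + l) v = a"
      using Suc.prems assms(1) by (simp add: k lookup_add lookup_single)
    from Suc.IH[OF this] have "0 = Poly_Mapping.lookup (poly_var v * f) (?e v + (?e u + l))"
      by (simp add: poly_var_def lookup_monomial_mult)
    also have "\<dots> = Poly_Mapping.lookup (poly_var u * f) (?e u + k)"
      by (simp add: eq k add.left_commute)
    also have "\<dots> = Poly_Mapping.lookup f k"
      by (simp add: poly_var_def lookup_monomial_mult)
    finally show ?case by simp
  qed
  then show "Poly_Mapping.lookup f k = Poly_Mapping.lookup 0 k" by simp
qed

lemma generic_z_var: "generic d (\<lambda>r. - z_var (Suc r) :: 'k::comm_ring_1 omega_y_z_poly)"
  unfolding generic_def
proof (intro allI impI)
  fix i j and f :: "'k omega_y_z_poly"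
  assume "i \<noteq> j" "(- z_var (Suc i) - - z_var (Suc j)) * f = 0"
  then show "f = 0"
    using poly_var_diff_cancel[of "Z_idx (Suc j)" "Z_idx (Suc i)" f] by (simp add: z_var_def)
qed

section \<open>The coefficient of the longest permutation\<close>

lemma A_elt_class:
  fixes t :: "'a::comm_ring_1"
  assumes "1 \<le> i"
  shows "A_elt N i t = nc_class N (descending_prod N i t)"
proof -
  have "map (\<lambda>j. \<one>\<^bsub>nilcoxeter N\<^esub> \<oplus>\<^bsub>nilcoxeter N\<^esub> nc_smult N t (nc_gen N j)) (rev [i..<N])
      = map (nc_class N) (map (\<lambda>j. lin_factor j t) (rev [i..<N]))"
    unfolding map_map
  proof (rule map_cong[OF refl])
    fix j assume "j \<in> set (rev [i..<N])"
    then have "(free_gen j :: word \<Rightarrow>\<^sub>0 'a) \<in> carrier (free_alg N)"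
      using assms by (intro free_alg_gen) auto
    then show "\<one>\<^bsub>nilcoxeter N\<^esub> \<oplus>\<^bsub>nilcoxeter N\<^esub> nc_smult N t (nc_gen N j) = (nc_class N \<circ> (\<lambda>j. lin_factor j t)) j"
      by (simp add: nc_class_one nc_gen_def nc_smult_class nc_class_add free_alg_1 free_alg_mult free_alg_scalar lin_factor_def)
  qed
  then show ?thesis
    unfolding A_elt_def descending_prod_def using assms by (simp only:) (rule nc_prod_class, auto intro!: lin_factor_carrier)
qed

lemma A_tilde_elt_class:
  assumes "1 \<le> i"
  shows "A_tilde_elt N i t = nc_class N (ascending_prod N i (- t))"
proof -
  interpret ring "nilcoxeter N :: (word \<Rightarrow>\<^sub>0 'a) set ring" by (rule ring_nilcoxeter)
  note car = ascending_prod_carrier[OF assms, of N "- t"] descending_prod_carrier[OF assms, of N t]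
  show ?thesis
    unfolding A_tilde_elt_def A_elt_class[OF assms]
  proof (rule inv_char)
    show "nc_class N (descending_prod N i t) \<otimes>\<^bsub>nilcoxeter N\<^esub> nc_class N (ascending_prod N i (- t)) = \<one>\<^bsub>nilcoxeter N\<^esub>"
      using descending_ascending_inverse(1)[OF assms, of N t] car
      by (simp add: nc_class_mult nc_class_one nc_class_eq_iff free_alg_mult free_alg_1)
    show "nc_class N (ascending_prod N i (- t)) \<otimes>\<^bsub>nilcoxeter N\<^esub> nc_class N (descending_prod N i t) = \<one>\<^bsub>nilcoxeter N\<^esub>"
      using descending_ascending_inverse(2)[OF assms, of N t] car
      by (simp add: nc_class_mult nc_class_one nc_class_eq_iff free_alg_mult free_alg_1)
  qed (use car in \<open>auto intro: nc_class_carrier\<close>)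
qed

lemma schubert_tilde_class:
  assumes N: "m + n = N" and n: "n = Suc d"
  shows "schubert_tilde m n \<omega> y z = nc_class N
     (prod_list (map (\<lambda>k. descending_prod N k (\<omega> k)) [1..<Suc m])
       * prod_list (map (\<lambda>k. descending_prod N (m + k) (y k)) [1..<Suc d])
       * stair_prod N (Suc m) d (\<lambda>r. - z (Suc r)))"
proof -
  let ?fs = "map (\<lambda>k. descending_prod N k (\<omega> k)) [1..<Suc m] @ map (\<lambda>k. descending_prod N (m + k) (y k)) [1..<Suc d]
    @ map (\<lambda>k. ascending_prod N (m + k) (- z k)) (rev [1..<Suc d])"
  have "schubert_tilde m n \<omega> y z = nc_prod N (map (nc_class N) ?fs)"
    unfolding schubert_tilde_def N
    by (intro arg_cong[where f = "nc_prod N"]) (auto simp: A_elt_class A_tilde_elt_class n)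
  also have "\<dots> = nc_class N (prod_list ?fs)"
    by (intro nc_prod_class) (auto intro!: descending_prod_carrier ascending_prod_carrier)
  also have "rev [1..<Suc d] = map Suc (rev [0..<d])"
    by (simp only: One_nat_def map_Suc_upt[symmetric] rev_map)
  then have "prod_list (map (\<lambda>k. ascending_prod N (m + k) (- z k)) (rev [1..<Suc d])) = stair_prod N (Suc m) d (\<lambda>r. - z (Suc r))"
    by (simp add: stair_prod_def comp_def)
  then have "prod_list ?fs = prod_list (map (\<lambda>k. descending_prod N k (\<omega> k)) [1..<Suc m])
       * prod_list (map (\<lambda>k. descending_prod N (m + k) (y k)) [1..<Suc d])
       * stair_prod N (Suc m) d (\<lambda>r. - z (Suc r))"
    by (simp add: mult.assoc del: upt_Suc)
  finally show ?thesis .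
qed

lemma shift_longest_perm: "shift_perm m (longest_perm n) = word_perm (stair_word (Suc m) (m + n))" if "n \<ge> 1"
  using that by (auto simp: fun_eq_iff word_perm_stair_word shift_perm_def longest_perm_def)

text \<open>The theorem for elements \<open>\<omega>, y, z\<close> of an arbitrary commutative ring in which the differences of \<open>z\<^sub>1, \<dots>, z\<^sub>n\<close> are not zero divisors.\<close>

lemma schubert_tilde_longest_det:
  fixes z :: "nat \<Rightarrow> 'a::comm_ring_1"
  assumes n: "n = Suc d" and z: "generic d (\<lambda>r. - z (Suc r))"
  shows "schubert_tilde_longest m n \<omega> y z = shifted_det d (\<lambda>r. prod_list (map geometric_fps
     (map \<omega> [1..<m + 1] @ map y [1..<r + 2] @ map (\<lambda>k. - z k) [1..<r + 2])))"
proof -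
  define N where "N = m + n"
  have N: "N = Suc m + d" by (simp add: N_def n)
  define e where "e = stair_word (Suc m) N"
  define S where "S = perm_words {Suc m..<N} (length e) (word_perm e)"
  have w: "shift_perm m (longest_perm n) = word_perm e"
    using shift_longest_perm[of n m] n by (simp add: e_def N_def)
  have minimal: "length e \<le> length b" if "word_perm b = word_perm e" for b
    using that stair_word_minimal[of "Suc m" N b] by (simp add: e_def N)
  have S: "nil_closed S"
    unfolding S_def by (rule nil_closed_perm_words) (rule minimal)
  have e: "e \<in> S" "set e \<subseteq> {1..<N}"
    using set_stair_word[of "Suc m" N] by (auto simp: S_def perm_words_def e_def)
  have reduced: "reduced_word N e (word_perm e)"
    using e minimal by (auto simp: reduced_word_def)
  let ?P = "prod_list (map (\<lambda>k. descending_prod N k (\<omega> k)) [1..<Suc m]) * prod_list (map (\<lambda>k. descending_prod N (m + k) (y k)) [1..<Suc d])"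
  let ?g = "\<lambda>r. prod_list (map (\<lambda>k. geometric_fps (\<omega> k)) [1..<Suc m]) * prod_list (map (\<lambda>k. geometric_fps (y k)) [1..<Suc (Suc r)])"
  have P: "represents S (Suc m) d ?P ?g"
    unfolding N
  proof (rule represents_product[OF S])
    show "set a \<subseteq> {Suc m..}" if "a \<in> S" for a
      using that by (auto simp: S_def perm_words_def)
    show "length (stair_word (Suc m) (Suc m + d)) \<le> length a" if "a \<in> S" for a
      using that by (simp add: S_def perm_words_def e_def N)
    show "stair_word (Suc m) (Suc m + d) \<in> S"
      using e(1) by (simp add: e_def N)
  qed
  have "schubert_tilde_longest m n \<omega> y z
      = nc_coeff N (nc_class N (?P * stair_prod N (Suc m) d (\<lambda>r. - z (Suc r)))) (word_perm e)"
    by (simp only: schubert_tilde_longest_def schubert_tilde_class[OF N_def[symmetric] n] w flip: N_def)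
  also have "\<dots> = word_sum S (?P * stair_prod N (Suc m) d (\<lambda>r. - z (Suc r)))"
  proof (rule nc_coeff_eq_word_sum[OF _ S _ e(1) reduced])
    have "?P \<in> carrier (free_alg N)"
      using P by (simp only: represents_def N)
    then show "?P * stair_prod N (Suc m) d (\<lambda>r. - z (Suc r)) \<in> carrier (free_alg N)"
      by (rule free_alg_mult) (rule stair_carrier, simp)
    show "word_perm a = word_perm e" if "a \<in> S" for a
      using that by (simp add: S_def perm_words_def)
  qed
  also have "\<dots> = shifted_det d (\<lambda>r. (\<Prod>j\<le>r. geometric_fps (- z (Suc j))) * ?g r)"
    using P z unfolding represents_def N[symmetric] by blast
  also have "\<dots> = shifted_det d (\<lambda>r. prod_list (map geometric_fps
     (map \<omega> [1..<m + 1] @ map y [1..<r + 2] @ map (\<lambda>k. - z k) [1..<r + 2])))"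
  proof (rule shifted_det_cong)
    fix r
    have "(\<Prod>j\<le>r. geometric_fps (- z (Suc j))) = (\<Prod>k\<in>set [1..<r + 2]. geometric_fps (- z k))"
      by (rule prod.reindex_bij_witness[of _ "\<lambda>k. k - 1" Suc]) auto
    also have "\<dots> = prod_list (map (\<lambda>k. geometric_fps (- z k)) [1..<r + 2])"
      by (rule prod.distinct_set_conv_list) simp
    finally show "(\<Prod>j\<le>r. geometric_fps (- z (Suc j))) * ?g r = prod_list (map geometric_fps
       (map \<omega> [1..<m + 1] @ map y [1..<r + 2] @ map (\<lambda>k. - z k) [1..<r + 2]))"
      by (simp add: comp_def mult_ac del: upt_Suc)
  qed
  finally show ?thesis .
qed

lemma map_omega_plus:
  "map (omega_plus m \<omega> y) [1..<m + k + 1] = map \<omega> [1..<m + 1] @ map y [1..<k + 1]"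
proof (induction k)
  case 0
  show ?case by (auto simp: omega_plus_def)
next
  case (Suc k)
  then show ?case by (simp add: omega_plus_def)
qed

theorem proposition2p5:
  fixes m n :: nat
  assumes "n \<ge> 1"
  shows "(schubert_tilde_longest m n omega_var y_var z_var :: 'k::comm_ring_1 omega_y_z_poly)
           = flagged_schur (delta (n - 1)) (delta_vee (n - 1) m) (delta_vee (n - 1) 0)
               (omega_plus m omega_var y_var) z_var
       \<and> (schubert_tilde_longest m n omega_var y_var z_var :: 'k omega_y_z_poly)
           = det (mat (n - 1) (n - 1) (\<lambda>(r, s).
               let i = r + 1; j = s + 1 in
               complete_sym (int n - int i + int j - int i)
                 (map omega_var [1..<m + 1] @ map y_var [1..<i + 1]
                  @ map (\<lambda>k. - z_var k) [1..<i + 1])))"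
proof -
  define d where "d = n - 1"
  have n: "n = Suc d" using assms by (simp add: d_def)
  let ?xs = "\<lambda>r. map omega_var [1..<m + 1] @ map y_var [1..<r + 2] @ map (\<lambda>k. - z_var k) [1..<r + 2]
    :: 'k omega_y_z_poly list"
  let ?D = "det (mat d d (\<lambda>(r, s). complete_sym (int d + int s - 2 * int r) (?xs r)))"
  have "schubert_tilde_longest m n omega_var y_var z_var = ?D"
    unfolding schubert_tilde_longest_det[OF n generic_z_var] shifted_det_def complete_sym_eq_int_coeff by simp
  moreover have "?D = flagged_schur (delta (n - 1)) (delta_vee (n - 1) m) (delta_vee (n - 1) 0)
               (omega_plus m omega_var y_var) z_var"
    unfolding flagged_schur_def
  proof (intro arg_cong[where f = det] eq_matI)
    fix r s assume *: "r < dim_row (mat (length (delta (n - 1))) (length (delta (n - 1))) (\<lambda>(i, j).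
       complete_sym (int (delta (n - 1) ! i) + int j - int i)
         (map (omega_plus m omega_var y_var) [1..<delta_vee (n - 1) m ! i + 1]
            @ map (\<lambda>k. - z_var k) [1..<delta_vee (n - 1) 0 ! i + 1]) :: 'k omega_y_z_poly))"
      "s < dim_col (mat (length (delta (n - 1))) (length (delta (n - 1))) (\<lambda>(i, j).
       complete_sym (int (delta (n - 1) ! i) + int j - int i)
         (map (omega_plus m omega_var y_var) [1..<delta_vee (n - 1) m ! i + 1]
            @ map (\<lambda>k. - z_var k) [1..<delta_vee (n - 1) 0 ! i + 1]) :: 'k omega_y_z_poly))"
    then have r: "r < d" "s < d" by (simp_all add: delta_def n del: upt_Suc)
    have "delta d ! r = d - r" "delta_vee d m ! r = m + (r + 1)" "delta_vee d 0 ! r = r + 1"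
      using r by (auto simp: delta_def delta_vee_def rev_nth simp del: upt_Suc)
    moreover have "map (omega_plus m omega_var y_var) [1..<m + (r + 1) + 1]
        = (map omega_var [1..<m + 1] @ map y_var [1..<r + 2] :: 'k omega_y_z_poly list)"
      using map_omega_plus[of m omega_var y_var "r + 1"] by simp
    ultimately show "mat d d (\<lambda>(r, s). complete_sym (int d + int s - 2 * int r) (?xs r)) $$ (r, s) =
      mat (length (delta (n - 1))) (length (delta (n - 1))) (\<lambda>(i, j).
       complete_sym (int (delta (n - 1) ! i) + int j - int i)
         (map (omega_plus m omega_var y_var) [1..<delta_vee (n - 1) m ! i + 1]
            @ map (\<lambda>k. - z_var k) [1..<delta_vee (n - 1) 0 ! i + 1])) $$ (r, s)"
      using r by (simp add: n delta_def algebra_simps of_nat_diff del: upt_Suc)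
  qed (auto simp: delta_def n)
  moreover have "?D = det (mat (n - 1) (n - 1) (\<lambda>(r, s).
               let i = r + 1; j = s + 1 in
               complete_sym (int n - int i + int j - int i)
                 (map omega_var [1..<m + 1] @ map y_var [1..<i + 1]
                  @ map (\<lambda>k. - z_var k) [1..<i + 1])))"
    by (intro arg_cong[where f = det] eq_matI) (auto simp: n Let_def algebra_simps simp del: upt_Suc)
  ultimately show ?thesis by simp
qed

end
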